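(* Let $k_0\geq 1$ be an integer and let $\alpha_1=4k_0^2+1$. The coordinate-free flame front model with normal velocity $U$ given by $$-U=1+(\alpha-1)\kappa+4\kappa_{ss}$$ has infinitely many vertically traveling solutions, i.e. solutions satisfying $U=-\beta\cos(\theta)$ and $V=-\beta\sin(\theta)$, in the neighbourhood of $(\theta,\beta,\alpha)=(0,1,\alpha_1)$. That is, with $$G(\theta,\beta;\alpha)=1+(\alpha-1)\frac{\theta_\sigma}{s_\sigma}+\frac{4\theta_{\sigma\sigma\sigma}}{s_\sigma^3}-\beta\cos(\theta),$$ there exist $\delta>0$ and a nontrivial continuously differentiable curve $$\{(\theta(\varpi),\beta(\varpi),\alpha(\varpi)):\ \varpi\in(-\delta,\delta)\}\subset H^3_{\mathrm{odd}}\times\mathbb{R}\times\mathbb{R},\qquad (\theta(0),\beta(0),\alpha(0))=(0,1,\alpha_1),$$ such that $G(\theta(\varpi),\beta(\varpi);\alpha(\varpi))=0$ for all $\varpi\in(-\delta,\delta)$.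
   Context: The flame front is a planar curve $(x(\sigma,t),y(\sigma,t))$, horizontally periodic: $x(\sigma+2\pi,t)=x(\sigma,t)+2\pi$, $y(\sigma+2\pi,t)=y(\sigma,t)$. It moves by $(x,y)_t=U\mathbf{\hat n}+V\mathbf{\hat t}$, where $\theta$ is the tangent angle the curve forms with the horizontal, $\mathbf{\hat t}=(\cos\theta,\sin\theta)$, $\mathbf{\hat n}=(-\sin\theta,\cos\theta)$, $U$ is the normal velocity and $V$ the tangential velocity. Here $\kappa=\theta_\sigma/s_\sigma$ is the curvature, $s$ is arclength, $\frac{d}{ds}=\frac{1}{s_\sigma}\frac{d}{d\sigma}$, and $\alpha\in\mathbb{R}$ is a parameter. A vertically traveling solution with velocity $(0,-\beta)$, $\beta\in\mathbb{R}$, is one with $(x_t,y_t)=(0,-\beta)$; equivalently $U=-\beta\cos(\theta)$ and $V=-\beta\sin(\theta)$. The curve is parameterized by normalized arclength, so $(x_\sigma,y_\sigma)=\frac{L}{2\pi}(\cos\theta(\sigma),\sin\theta(\sigma))$ and $s_\sigma=\frac{L}{2\pi}$ is independent of $\sigma$, where $L$ is the length of one period of the curve. By periodicity $L$ is determined by $\theta$: $$L=\frac{4\pi^2}{\int_0^{2\pi}\cos(\theta(\sigma))\,d\sigma},\qquad\text{so}\qquad s_\sigma=\frac{2\pi}{\int_0^{2\pi}\cos(\theta(\sigma))\,d\sigma}$$ (considered for $\theta$ near $0$, where the integral is positive). The unknown is $\theta$, and with $V=-\beta\sin\theta$ fixing the parameterization, the vertically traveling waves are the solutions of $G(\theta,\beta;\alpha)=0$.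 $H^3_{\mathrm{odd}}$ denotes the Sobolev space $H^3$ of real $2\pi$-periodic functions of $\sigma$, restricted to those with Fourier sine series expansions; $L^2_{\mathrm{even}}$ denotes the $2\pi$-periodic $L^2$ functions with Fourier cosine series expansions. $G$ takes $(\theta,\beta,\alpha)\in H^3_{\mathrm{odd}}\times\mathbb{R}\times\mathbb{R}$ (with $\theta$ near $0$) to $L^2_{\mathrm{even}}$. The trivial solutions are $(\theta,\beta,\alpha)=(0,1,\alpha)$, $\alpha\in\mathbb{R}$, for which $G=0$; "nontrivial curve" is meant in the usual sense of bifurcation theory: apart from the point $\varpi=0$, the points of the curve are not trivial solutions. *)

theory Defs
  imports "HOL-Analysis.Analysis"
begin

section \<open>Periodic Sobolev spaces\<close>

text \<open>Square integrable \<open>2\<pi>\<close>-periodic functions. Elements of \<open>L\<^sup>2\<close> are represented by Borel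
  functions, and equality in \<open>L\<^sup>2\<close> is equality almost everywhere.\<close>

definition L2_periodic :: "(real \<Rightarrow> real) set" where
  "L2_periodic = {f. f \<in> borel_measurable borel \<and> periodic_fun_simple f (2*pi) \<and>
     set_integrable lborel {0..2*pi} (\<lambda>x. (f x)\<^sup>2)}"

definition smooth_periodic :: "(real \<Rightarrow> real) set" where
  "smooth_periodic = {\<phi>. periodic_fun_simple \<phi> (2*pi) \<and>
     (\<forall>n x. (deriv ^^ n) \<phi> differentiable at x)}"

definition has_weak_deriv :: "nat \<Rightarrow> (real \<Rightarrow> real) \<Rightarrow> (real \<Rightarrow> real) \<Rightarrow> bool" where
  "has_weak_deriv n f g \<longleftrightarrow> (\<forall>\<phi>\<in>smooth_periodic.
     (LINT x:{0..2*pi}|lborel. f x * (deriv ^^ n) \<phi> x) =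
     (-1) ^ n * (LINT x:{0..2*pi}|lborel. g x * \<phi> x))"

text \<open>The weak derivative is only determined up to null sets (see \<open>weak_deriv_unique\<close>
  below); the choice of representative never matters.\<close>

definition weak_deriv :: "nat \<Rightarrow> (real \<Rightarrow> real) \<Rightarrow> real \<Rightarrow> real" where
  "weak_deriv n f = (SOME g. g \<in> L2_periodic \<and> has_weak_deriv n f g)"

definition sobolev_periodic :: "nat \<Rightarrow> (real \<Rightarrow> real) set" where
  "sobolev_periodic k = {f \<in> L2_periodic. \<forall>j\<le>k. \<exists>g\<in>L2_periodic. has_weak_deriv j f g}"

subsection \<open>Uniqueness of weak derivatives\<close>

lemma periodic_comb:
  assumes "periodic_fun_simple f p" "periodic_fun_simple g p"
  shows "periodic_fun_simple (\<lambda>x. h (f x) (g x)) p"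
  using assms by (simp add: periodic_fun_simple_def)

lemma L2_periodicD:
  assumes "f \<in> L2_periodic"
  shows "f \<in> borel_measurable borel" "periodic_fun_simple f (2*pi)"
    "set_integrable lborel {0..2*pi} (\<lambda>x. (f x)\<^sup>2)"
  using assms by (auto simp: L2_periodic_def)

lemma L2_mult_integrable:
  assumes f: "f \<in> L2_periodic" and g: "g \<in> L2_periodic"
  shows "set_integrable lborel {0..2*pi} (\<lambda>x. f x * g x)"
proof -
  note [measurable] = L2_periodicD(1)[OF f] L2_periodicD(1)[OF g]
  have "set_integrable lborel {0..2*pi} (\<lambda>x. (f x)\<^sup>2 + (g x)\<^sup>2)"
    using L2_periodicD(3)[OF f] L2_periodicD(3)[OF g] by (rule set_integral_add)
  then show ?thesis
    unfolding set_integrable_def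
  proof (rule Bochner_Integration.integrable_bound)
    show "AE x in lborel. norm (indicator {0..2*pi} x *\<^sub>R (f x * g x))
        \<le> norm (indicator {0..2*pi} x *\<^sub>R ((f x)\<^sup>2 + (g x)\<^sup>2))"
    proof (intro AE_I2)
      fix x :: real
      have "2 * (\<bar>f x\<bar> * \<bar>g x\<bar>) \<le> (f x)\<^sup>2 + (g x)\<^sup>2"
        using sum_squares_bound[of "\<bar>f x\<bar>" "\<bar>g x\<bar>"] by (simp add: mult.assoc)
      moreover have "0 \<le> \<bar>f x\<bar> * \<bar>g x\<bar>" by simp
      ultimately have "\<bar>f x\<bar> * \<bar>g x\<bar> \<le> (f x)\<^sup>2 + (g x)\<^sup>2" by linarith
      then show "norm (indicator {0..2*pi} x *\<^sub>R (f x * g x))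
        \<le> norm (indicator {0..2*pi} x *\<^sub>R ((f x)\<^sup>2 + (g x)\<^sup>2))"
        by (auto simp: indicator_def abs_mult)
    qed
  qed measurable
qed

lemma L2_add:
  assumes f: "f \<in> L2_periodic" and g: "g \<in> L2_periodic"
  shows "(\<lambda>x. f x + g x) \<in> L2_periodic"
proof -
  have "set_integrable lborel {0..2*pi} (\<lambda>x. ((f x)\<^sup>2 + (g x)\<^sup>2) + 2 * (f x * g x))"
    using f g by (intro set_integral_add L2_periodicD set_integrable_mult_right L2_mult_integrable)
  then have "set_integrable lborel {0..2*pi} (\<lambda>x. (f x + g x)\<^sup>2)"
    by (simp add: power2_sum algebra_simps)
  then show ?thesis
    using f g by (auto simp: L2_periodic_def intro: periodic_comb)
qed

lemma L2_cmult:
  assumes f: "f \<in> L2_periodic"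
  shows "(\<lambda>x. c * f x) \<in> L2_periodic"
proof -
  have "set_integrable lborel {0..2*pi} (\<lambda>x. c\<^sup>2 * (f x)\<^sup>2)"
    using f by (intro L2_periodicD set_integrable_mult_right)
  then show ?thesis
    using f by (auto simp: L2_periodic_def power_mult_distrib periodic_fun_simple_def)
qed

lemma L2_diff:
  assumes "f \<in> L2_periodic" "g \<in> L2_periodic"
  shows "(\<lambda>x. f x - g x) \<in> L2_periodic"
  using L2_add[OF assms(1) L2_cmult[OF assms(2), of "-1"]] by simp

lemma L2_continuous:
  assumes "continuous_on UNIV f" "periodic_fun_simple f (2*pi)"
  shows "f \<in> L2_periodic"
proof -
  have "set_integrable lborel {0..2*pi} (\<lambda>x. (f x)\<^sup>2)"
    by (intro borel_integrable_atLeastAtMost' continuous_intros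
        continuous_on_subset[OF assms(1)]) auto
  then show ?thesis
    using assms by (auto simp: L2_periodic_def intro: borel_measurable_continuous_onI)
qed

lemma deriv_periodic:
  assumes "periodic_fun_simple \<phi> p"
  shows "periodic_fun_simple ((deriv ^^ n) \<phi>) (p::real)"
proof (induction n)
  case (Suc n)
  let ?f = "(deriv ^^ n) \<phi>"
  have eq: "(\<lambda>x. ?f (x + p)) = ?f"
    using Suc by (auto simp: periodic_fun_simple_def)
  have "deriv ?f (x + p) = deriv ?f x" for x
  proof -
    have "(?f has_field_derivative D) (at (x + p)) \<longleftrightarrow> (?f has_field_derivative D) (at x)" for D
      using DERIV_shift[of ?f D x p] by (simp add: eq)
    then show ?thesis by (simp add: deriv_def)
  qed
  then show ?case by (simp add: periodic_fun_simple_def)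
qed (use assms in simp)

lemma smooth_periodic_deriv:
  assumes "\<phi> \<in> smooth_periodic"
  shows "(deriv ^^ n) \<phi> \<in> smooth_periodic"
proof -
  have "(deriv ^^ m) ((deriv ^^ n) \<phi>) = (deriv ^^ (m + n)) \<phi>" for m
    by (simp add: funpow_add)
  then show ?thesis
    using assms deriv_periodic by (auto simp: smooth_periodic_def)
qed

lemma smooth_periodic_L2:
  assumes "\<phi> \<in> smooth_periodic"
  shows "\<phi> \<in> L2_periodic"
proof (rule L2_continuous)
  have "\<forall>x. \<phi> differentiable at x"
    using assms unfolding smooth_periodic_def by (metis (mono_tags, lifting) funpow_0 mem_Collect_eq)
  then show "continuous_on UNIV \<phi>"
    by (simp add: continuous_at_imp_continuous_on differentiable_imp_continuous_within)
qed (use assms in \<open>simp add: smooth_periodic_def\<close>)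

lemma weak_test_integrable:
  assumes "g \<in> L2_periodic" "\<phi> \<in> smooth_periodic"
  shows "set_integrable lborel {0..2*pi} (\<lambda>x. g x * (deriv ^^ n) \<phi> x)"
  by (rule L2_mult_integrable[OF assms(1) smooth_periodic_L2[OF smooth_periodic_deriv[OF assms(2)]]])

definition trig_poly :: "real \<Rightarrow> (real \<Rightarrow> real) set" where
  "trig_poly m = {f. \<exists>p q. real_polynomial_function p \<and> real_polynomial_function q \<and>
     f = (\<lambda>x. p (cos (x - m)) + q (cos (x - m)) * sin (x - m))}"

lemma trig_poly_deriv:
  assumes "f \<in> trig_poly m"
  shows "f differentiable at x" "deriv f \<in> trig_poly m"
proof -
  obtain p q where pq: "real_polynomial_function p" "real_polynomial_function q"
    and f: "f = (\<lambda>x. p (cos (x - m)) + q (cos (x - m)) * sin (x - m))"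
    using assms by (auto simp: trig_poly_def)
  obtain p' where p': "real_polynomial_function p'" "\<And>x. (p has_real_derivative p' x) (at x)"
    using has_real_derivative_polynomial_function[OF pq(1)] by blast
  obtain q' where q': "real_polynomial_function q'" "\<And>x. (q has_real_derivative q' x) (at x)"
    using has_real_derivative_polynomial_function[OF pq(2)] by blast
  let ?a = "\<lambda>y. q y * y - q' y * (1 - y * y)" and ?b = "\<lambda>y. - p' y"
  have D: "(f has_real_derivative (?a (cos (x - m)) + ?b (cos (x - m)) * sin (x - m))) (at x)" for x
  proof -
    have s: "sin (x - m) * sin (x - m) = 1 - cos (x - m) * cos (x - m)"
      using sin_cos_squared_add3[of "x - m"] by linarith
    have "(f has_real_derivative (p' (cos (x - m)) * - sin (x - m) +
        (q' (cos (x - m)) * - sin (x - m) * sin (x - m) + q (cos (x - m)) * cos (x - m)))) (at x)"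
      unfolding f
      by (auto intro!: derivative_eq_intros DERIV_chain2[OF p'(2)] DERIV_chain2[OF q'(2)])
    moreover have "p' (cos (x - m)) * - sin (x - m) +
        (q' (cos (x - m)) * - sin (x - m) * sin (x - m) + q (cos (x - m)) * cos (x - m))
      = ?a (cos (x - m)) + ?b (cos (x - m)) * sin (x - m)"
      unfolding s[symmetric] by (simp add: algebra_simps)
    ultimately show ?thesis by (simp only:)
  qed
  show "f differentiable at x"
    using D real_differentiable_def by blast
  have "deriv f = (\<lambda>x. ?a (cos (x - m)) + ?b (cos (x - m)) * sin (x - m))"
    using D by (intro ext DERIV_imp_deriv)
  moreover have id: "real_polynomial_function (\<lambda>y. y)"
    by (intro real_polynomial_function.intros bounded_linear_ident)
  have "real_polynomial_function ?a" "real_polynomial_function ?b"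
    by (intro real_polynomial_function_diff real_polynomial_function_minus
        real_polynomial_function.intros(2-) pq p'(1) q'(1) id)+
  ultimately show "deriv f \<in> trig_poly m"
    unfolding trig_poly_def by blast
qed

lemma poly_cos_smooth:
  assumes "real_polynomial_function p"
  shows "(\<lambda>x. p (cos (x - m))) \<in> smooth_periodic"
proof -
  let ?f = "\<lambda>x. p (cos (x - m))"
  have "(deriv ^^ n) ?f \<in> trig_poly m" for n
  proof (induction n)
    case 0
    have "real_polynomial_function (\<lambda>_::real. 0)" by (rule real_polynomial_function.intros)
    then show ?case using assms by (force simp: trig_poly_def)
  next
    case (Suc n)
    then show ?case using trig_poly_deriv(2) by simp
  qed
  then have "\<forall>n x. (deriv ^^ n) ?f differentiable at x"
    using trig_poly_deriv(1) by blast
  moreover have "x + 2 * pi - m = (x - m) + 2 * pi" for x by simp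
  then have "periodic_fun_simple ?f (2*pi)"
    unfolding periodic_fun_simple_def by (metis cos_periodic)
  ultimately show ?thesis by (simp add: smooth_periodic_def)
qed

lemma L2_integrable:
  assumes "g \<in> L2_periodic"
  shows "set_integrable lborel {0..2*pi} g"
proof -
  have "(\<lambda>_. 1) \<in> L2_periodic"
    by (intro L2_continuous) (auto simp: periodic_fun_simple_def)
  from L2_mult_integrable[OF assms this] show ?thesis by simp
qed

text \<open>Indicators of intervals are bounded pointwise limits of trigonometric polynomials.\<close>

lemma interval_integral_zero:
  assumes g: "g \<in> L2_periodic"
    and z: "\<And>\<phi>. \<phi> \<in> smooth_periodic \<Longrightarrow> (LINT x:{0..2*pi}|lborel. g x * \<phi> x) = 0"
    and ab: "0 \<le> a" "a < b" "b \<le> 2*pi"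
  shows "(LINT x:{a<..<b}|lborel. g x) = 0"
proof -
  note [measurable] = L2_periodicD(1)[OF g]
  define m where "m = (a + b) / 2"
  define c where "c = cos ((b - a) / 2)"
  have "\<exists>p. real_polynomial_function p \<and>
      (\<forall>y\<in>{-1..1}. \<bar>min 1 (max 0 (real n * (y - c))) - p y\<bar> < 1 / real (Suc n))" for n :: nat
    by (rule Stone_Weierstrass_real_polynomial_function[of "{-1..1::real}"
          "\<lambda>y. min 1 (max 0 (real n * (y - c)))" "1 / real (Suc n)"])
       (auto intro!: continuous_intros simp del: of_nat_Suc)
  then obtain p where p: "\<And>n. real_polynomial_function (p n)"
    and pb: "\<And>n y. y \<in> {-1..1} \<Longrightarrow> \<bar>min 1 (max 0 (real n * (y - c))) - p n y\<bar> < 1 / real (Suc n)"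
    by metis
  have lim0: "(\<lambda>n. min 1 (max 0 (real n * d))) \<longlonglongrightarrow> (if d > 0 then 1 else 0)" for d :: real
  proof (cases "d > 0")
    case True
    obtain N where N: "1 / d \<le> real N" using real_arch_simple by blast
    have "min 1 (max 0 (real n * d)) = 1" if "n \<ge> N" for n
    proof -
      have "1 / d \<le> real n" using N that by linarith
      then show ?thesis using True by (simp add: field_simps)
    qed
    then show ?thesis using True by (auto intro!: tendsto_eventually eventually_sequentiallyI)
  next
    case False
    then have "max 0 (real n * d) = 0" for n by (simp add: mult_nonneg_nonpos)
    then show ?thesis using False by simp
  qed
  have lim: "(\<lambda>n. p n y) \<longlonglongrightarrow> (if y > c then 1 else 0)" if y: "y \<in> {-1..1}" for y
  proof -
    have "(\<lambda>n. min 1 (max 0 (real n * (y - c))) - p n y) \<longlonglongrightarrow> 0"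
      by (rule Lim_null_comparison[OF _ lim_1_over_n[THEN LIMSEQ_Suc, unfolded of_nat_Suc]])
         (use pb[OF y] less_imp_le in \<open>auto intro!: always_eventually simp: field_simps\<close>)
    from tendsto_diff[OF lim0[of "y - c"] this] show ?thesis by simp
  qed
  have bd: "\<bar>p n y\<bar> \<le> 2" if y: "y \<in> {-1..1}" for n y
  proof -
    have "1 / real (Suc n) \<le> 1" by simp
    moreover have "\<bar>min 1 (max 0 (real n * (y - c)))\<bar> \<le> 1" by simp
    ultimately show ?thesis using pb[OF y, of n] by linarith
  qed
  have iff: "cos (x - m) > c \<longleftrightarrow> a < x \<and> x < b" if x: "0 < x" "x < 2*pi" for x
  proof -
    have *: "cos (x - m) = cos \<bar>x - m\<bar>" by simp
    have d: "0 \<le> (b - a) / 2" "(b - a) / 2 \<le> pi" using ab by auto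
    show ?thesis
    proof (cases "\<bar>x - m\<bar> \<le> pi")
      case True
      then have "cos \<bar>x - m\<bar> > c \<longleftrightarrow> \<bar>x - m\<bar> < (b - a) / 2"
        unfolding c_def using d by (intro cos_mono_less_eq) auto
      then show ?thesis unfolding * by (auto simp: m_def field_simps abs_less_iff)
    next
      case False
      let ?z = "2 * pi - \<bar>x - m\<bar>"
      have r: "0 \<le> ?z" "?z \<le> pi" "?z \<ge> (b - a) / 2"
        using False x ab unfolding m_def by (auto simp: abs_if field_simps split: if_splits)
      have "cos ?z = cos \<bar>x - m\<bar>" by (simp add: cos_diff)
      moreover have "cos ?z \<le> c" unfolding c_def using r d by (intro cos_monotone_0_pi_le) auto
      moreover have "\<not> (a < x \<and> x < b)"
        using False ab unfolding m_def by (auto simp: abs_if field_simps split: if_splits)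
      ultimately show ?thesis unfolding * by auto
    qed
  qed
  let ?s = "\<lambda>n x. indicator {0..2*pi} x *\<^sub>R (g x * p n (cos (x - m)))"
  have "(\<lambda>n. integral\<^sup>L lborel (?s n)) \<longlonglongrightarrow> integral\<^sup>L lborel (\<lambda>x. indicator {a<..<b} x *\<^sub>R g x)"
  proof (rule integral_dominated_convergence[where w = "\<lambda>x. 2 * \<bar>indicator {0..2*pi} x *\<^sub>R g x\<bar>"])
    show "(\<lambda>x. indicator {a<..<b} x *\<^sub>R g x) \<in> borel_measurable lborel" by measurable
    show "?s n \<in> borel_measurable lborel" for n
    proof -
      have "p n \<in> borel_measurable borel"
        by (intro borel_measurable_continuous_onI continuous_on_polymonial_function)
          (use p real_polynomial_function_eq in auto)
      then have [measurable]: "(\<lambda>x. p n (cos (x - m))) \<in> borel_measurable borel" by measurable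
      show ?thesis by measurable
    qed
    show "integrable lborel (\<lambda>x. 2 * \<bar>indicator {0..2*pi} x *\<^sub>R g x\<bar>)"
      using L2_integrable[OF g] unfolding set_integrable_def
      by (intro integrable_mult_right integrable_abs)
    show "AE x in lborel. norm (?s n x) \<le> 2 * \<bar>indicator {0..2*pi} x *\<^sub>R g x\<bar>" for n
    proof (intro AE_I2)
      fix x :: real
      have "\<bar>g x\<bar> * \<bar>p n (cos (x - m))\<bar> \<le> \<bar>g x\<bar> * 2"
        by (intro mult_left_mono bd) auto
      then show "norm (?s n x) \<le> 2 * \<bar>indicator {0..2*pi} x *\<^sub>R g x\<bar>"
        by (auto simp: indicator_def abs_mult)
    qed
    have "AE x in lborel. x \<noteq> (0::real) \<and> x \<noteq> 2*pi"
      using AE_lborel_singleton[of "0::real"] AE_lborel_singleton[of "2*pi"] by eventually_elim auto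
    then show "AE x in lborel. (\<lambda>n. ?s n x) \<longlonglongrightarrow> indicator {a<..<b} x *\<^sub>R g x"
    proof eventually_elim
      case (elim x)
      show ?case
      proof (cases "0 < x \<and> x < 2*pi")
        case True
        have "(\<lambda>n. g x * p n (cos (x - m))) \<longlonglongrightarrow> g x * (if cos (x - m) > c then 1 else 0)"
          by (intro tendsto_intros lim) auto
        then show ?thesis
          using True iff[of x] by (auto simp: indicator_def split: if_splits)
      next
        case False
        then show ?thesis using elim ab by (auto simp: indicator_def)
      qed
    qed
  qed
  moreover have "integral\<^sup>L lborel (?s n) = 0" for n
    using z[OF poly_cos_smooth[OF p]] by (simp only: set_lebesgue_integral_def)
  ultimately have "(\<lambda>n. 0) \<longlonglongrightarrow> integral\<^sup>L lborel (\<lambda>x. indicator {a<..<b} x *\<^sub>R g x)"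
    by (simp only:)
  then show ?thesis
    unfolding set_lebesgue_integral_def by (simp only: LIMSEQ_const_iff)
qed

lemma AE_periodic:
  assumes f: "AE x in lborel. x \<in> {0<..<2*pi} \<longrightarrow> f x = (0::real)" and per: "periodic_fun_simple f (2*pi)"
    and [measurable]: "f \<in> borel_measurable borel"
  shows "AE x in lborel. f x = 0"
proof -
  interpret periodic_fun_simple f "2*pi" by (rule per)
  have "AE x in lborel. x + of_int k * (2*pi) \<in> {0<..<2*pi} \<longrightarrow> f (x + of_int k * (2*pi)) = 0" for k :: int
    using AE_borel_affine[of 1 "\<lambda>x. x \<in> {0<..<2*pi} \<longrightarrow> f x = 0" "of_int k * (2*pi)", OF _ _ f]
    by (simp add: add.commute)
  then have A: "AE x in lborel. \<forall>k::int. x + of_int k * (2*pi) \<in> {0<..<2*pi} \<longrightarrow> f x = 0"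
    by (subst AE_all_countable) (simp add: plus_of_int)
  have "AE x in lborel. \<forall>k::int. x \<noteq> - (of_int k * (2*pi))"
    unfolding AE_all_countable by (intro allI AE_lborel_singleton)
  with A show ?thesis
  proof eventually_elim
    case (elim x)
    define k where "k = - \<lfloor>x / (2*pi)\<rfloor>"
    have "of_int \<lfloor>x / (2*pi)\<rfloor> * (2*pi) \<le> x" "x < (of_int \<lfloor>x / (2*pi)\<rfloor> + 1) * (2*pi)"
      using of_int_floor_le[of "x / (2*pi)"]
        floor_correct[THEN conjunct2, of "x / (2*pi)"]
      by (simp_all only: pos_le_divide_eq[of "2*pi"] pos_divide_less_eq[of "2*pi"] pi_gt_zero
          zero_less_mult_iff zero_less_numeral simp_thms of_int_add of_int_1)
    then have "0 \<le> x + of_int k * (2*pi)" "x + of_int k * (2*pi) < 2*pi"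
      unfolding k_def by (simp_all add: distrib_right)
    moreover have "x + of_int k * (2*pi) \<noteq> 0"
      using elim(2)[rule_format, of k] by linarith
    ultimately show ?case using elim(1) by force
  qed
qed

lemma du_Bois_Reymond:
  assumes g: "g \<in> L2_periodic"
    and z: "\<And>\<phi>. \<phi> \<in> smooth_periodic \<Longrightarrow> (LINT x:{0..2*pi}|lborel. g x * \<phi> x) = 0"
  shows "AE x in lborel. g x = 0"
proof -
  note [measurable] = L2_periodicD(1)[OF g]
  define h where "h = (\<lambda>x. indicator {0<..<2*pi} x * g x)"
  have "integrable lborel (\<lambda>x. indicator {0<..<2*pi} x *\<^sub>R g x)"
    using set_integrable_subset[OF L2_integrable[OF g], of "{0<..<2*pi}"]
    by (force simp: set_integrable_def)
  then have h: "integrable lborel h" by (simp add: h_def)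
  have box: "set_lebesgue_integral lborel (box a b) h = 0" for a b :: real
  proof -
    have "(\<lambda>x. indicator (box a b) x *\<^sub>R h x)
      = (\<lambda>x. indicator {max a 0<..<min b (2*pi)} x *\<^sub>R g x)"
      by (auto simp: h_def indicator_def fun_eq_iff box_real)
    moreover have "(LINT x:{max a 0<..<min b (2*pi)}|lborel. g x) = 0"
    proof (cases "max a 0 < min b (2*pi)")
      case True
      then show ?thesis by (intro interval_integral_zero[OF g z]) auto
    next
      case False
      then have "{max a 0<..<min b (2*pi)} = {}" by auto
      then show ?thesis by (simp add: set_lebesgue_integral_def)
    qed
    ultimately show ?thesis by (simp add: set_lebesgue_integral_def)
  qed
  have UNIV0: "integral\<^sup>L lborel h = 0"
  proof -
    have "(\<lambda>x. indicator (box (-1) (2*pi+1)) x *\<^sub>R h x) = h"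
      by (auto simp: h_def indicator_def fun_eq_iff box_real)
    then show ?thesis using box[of "-1" "2*pi+1"] by (simp add: set_lebesgue_integral_def)
  qed
  have "set_lebesgue_integral lborel A h = 0" if "A \<in> sets lborel" for A
  proof -
    have A: "A \<in> sigma_sets UNIV (range (\<lambda>(a, b). box a b))"
      using that by (simp add: borel_eq_box)
    have I: "Int_stable (range (\<lambda>(a, b). box a b :: real set))"
      by (auto simp: Int_stable_def box_Int_box)
    have P: "range (\<lambda>(a, b). box a b) \<subseteq> Pow (UNIV :: real set)" by simp
    from I P A show ?thesis
    proof (induction rule: sigma_sets_induct_disjoint)
      case (basic A)
      then show ?case using box by auto
    next
      case empty
      show ?case by (simp add: set_lebesgue_integral_def)
    next
      case (compl A)
      then have A: "A \<in> sets lborel" by (simp add: borel_eq_box)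
      have "set_lebesgue_integral lborel (UNIV - A) h
          = (\<integral>x. h x - indicator A x *\<^sub>R h x \<partial>lborel)"
        unfolding set_lebesgue_integral_def
        by (intro Bochner_Integration.integral_cong) (auto simp: indicator_def)
      also have "\<dots> = integral\<^sup>L lborel h - set_lebesgue_integral lborel A h"
        unfolding set_lebesgue_integral_def
        using h integrable_mult_indicator[OF A h] by (intro Bochner_Integration.integral_diff) auto
      finally show ?case using compl UNIV0 by simp
    next
      case (union A)
      then have A: "A i \<in> sets lborel" for i by (auto simp: borel_eq_box)
      have U: "(\<Union>i. A i) \<in> sets lborel" using A by auto
      have "set_lebesgue_integral lborel (\<Union>i. A i) h = (\<Sum>i. set_lebesgue_integral lborel (A i) h)"
        using union.hyps(1) A integrable_mult_indicator[OF U h]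
        by (intro lebesgue_integral_countable_add) (auto simp: disjoint_family_on_def set_integrable_def)
      then show ?case using union.IH by simp
    qed
  qed
  then have "AE x in lborel. h x = 0" by (rule sigma_finite_measure.density_zero[OF sigma_finite_lborel h])
  then have "AE x in lborel. x \<in> {0<..<2*pi} \<longrightarrow> g x = 0"
    by eventually_elim (auto simp: h_def)
  then show ?thesis by (rule AE_periodic[OF _ L2_periodicD(2,1)[OF g]])
qed

lemma has_weak_deriv_comb:
  assumes "f \<in> L2_periodic" "f' \<in> L2_periodic" "g \<in> L2_periodic" "g' \<in> L2_periodic"
    and "has_weak_deriv n f g" "has_weak_deriv n f' g'"
  shows "has_weak_deriv n (\<lambda>x. a * f x + b * f' x) (\<lambda>x. a * g x + b * g' x)"
proof -
  have *: "(LINT x:{0..2*pi}|lborel. (a * u x + b * v x) * (deriv ^^ k) \<phi> x)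
      = a * (LINT x:{0..2*pi}|lborel. u x * (deriv ^^ k) \<phi> x)
      + b * (LINT x:{0..2*pi}|lborel. v x * (deriv ^^ k) \<phi> x)"
    if "u \<in> L2_periodic" "v \<in> L2_periodic" "\<phi> \<in> smooth_periodic" for u v \<phi> k
    using weak_test_integrable[OF that(1,3), of k] weak_test_integrable[OF that(2,3), of k]
    by (simp add: distrib_right mult.assoc set_integral_add)
  show ?thesis
    unfolding has_weak_deriv_def
  proof
    fix \<phi> assume \<phi>: "\<phi> \<in> smooth_periodic"
    show "(LINT x:{0..2*pi}|lborel. (a * f x + b * f' x) * (deriv ^^ n) \<phi> x) =
      (-1) ^ n * (LINT x:{0..2*pi}|lborel. (a * g x + b * g' x) * \<phi> x)"
      using assms(5,6) \<phi> *[OF assms(1,2) \<phi>, of n] *[OF assms(3,4) \<phi>, of 0]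
      unfolding has_weak_deriv_def by (simp add: algebra_simps)
  qed
qed

lemma weak_deriv_unique:
  assumes "f \<in> L2_periodic" "g \<in> L2_periodic" "h \<in> L2_periodic"
    and "has_weak_deriv n f g" "has_weak_deriv n f h"
  shows "AE x in lborel. g x = h x"
proof -
  have w: "has_weak_deriv n (\<lambda>x. 1 * f x + (-1) * f x) (\<lambda>x. 1 * g x + (-1) * h x)"
    using assms by (intro has_weak_deriv_comb)
  have "AE x in lborel. g x - h x = 0"
  proof (rule du_Bois_Reymond[OF L2_diff])
    fix \<phi> assume "\<phi> \<in> smooth_periodic"
    with w have "(-1) ^ n * (LINT x:{0..2*pi}|lborel. (g x - h x) * \<phi> x) = 0"
      unfolding has_weak_deriv_def by (simp add: set_lebesgue_integral_def)
    then show "(LINT x:{0..2*pi}|lborel. (g x - h x) * \<phi> x) = 0" by simp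
  qed (use assms in auto)
  then show ?thesis by simp
qed

lemma weak_deriv_sobolev:
  assumes "f \<in> sobolev_periodic k" "j \<le> k"
  shows "weak_deriv j f \<in> L2_periodic" "has_weak_deriv j f (weak_deriv j f)"
proof -
  have "\<exists>g. g \<in> L2_periodic \<and> has_weak_deriv j f g"
    using assms by (auto simp: sobolev_periodic_def)
  from someI_ex[OF this] show "weak_deriv j f \<in> L2_periodic" "has_weak_deriv j f (weak_deriv j f)"
    by (auto simp: weak_deriv_def)
qed

lemma weak_deriv_eqI:
  assumes "f \<in> L2_periodic" "g \<in> L2_periodic" "has_weak_deriv n f g"
  shows "AE x in lborel. weak_deriv n f x = g x"
proof -
  from assms have "\<exists>g. g \<in> L2_periodic \<and> has_weak_deriv n f g" by blast
  from someI_ex[OF this] show ?thesis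
    unfolding weak_deriv_def[symmetric] using assms weak_deriv_unique by blast
qed

lemma sobolev_L2: "f \<in> sobolev_periodic k \<Longrightarrow> f \<in> L2_periodic"
  by (simp add: sobolev_periodic_def)

lemma sobolev_comb:
  assumes f: "f \<in> sobolev_periodic k" and g: "g \<in> sobolev_periodic k"
  shows "(\<lambda>x. a * f x + b * g x) \<in> sobolev_periodic k"
    and "j \<le> k \<Longrightarrow> AE x in lborel. weak_deriv j (\<lambda>x. a * f x + b * g x) x
           = a * weak_deriv j f x + b * weak_deriv j g x"
proof -
  have L: "(\<lambda>x. a * f x + b * g x) \<in> L2_periodic"
    using f g by (intro L2_add L2_cmult sobolev_L2)
  have *: "(\<lambda>x. a * weak_deriv j f x + b * weak_deriv j g x) \<in> L2_periodic"
    "has_weak_deriv j (\<lambda>x. a * f x + b * g x) (\<lambda>x. a * weak_deriv j f x + b * weak_deriv j g x)"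
    if "j \<le> k" for j
    by (intro L2_add L2_cmult weak_deriv_sobolev[OF f that] weak_deriv_sobolev[OF g that]
        has_weak_deriv_comb sobolev_L2[OF f] sobolev_L2[OF g])+
  show "(\<lambda>x. a * f x + b * g x) \<in> sobolev_periodic k"
    using L * by (auto simp: sobolev_periodic_def)
  show "AE x in lborel. weak_deriv j (\<lambda>x. a * f x + b * g x) x
           = a * weak_deriv j f x + b * weak_deriv j g x" if "j \<le> k"
    using L *[OF that] by (rule weak_deriv_eqI)
qed

lemma weak_deriv_weak_deriv:
  assumes f: "f \<in> sobolev_periodic k" and "i + j \<le> k"
  shows "has_weak_deriv j (weak_deriv i f) (weak_deriv (i + j) f)"
  unfolding has_weak_deriv_def
proof
  fix \<phi> assume \<phi>: "\<phi> \<in> smooth_periodic"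
  have i: "has_weak_deriv i f (weak_deriv i f)" and ij: "has_weak_deriv (i + j) f (weak_deriv (i + j) f)"
    using weak_deriv_sobolev(2)[OF f] assms(2) by auto
  have "(-1) ^ i * (LINT x:{0..2*pi}|lborel. weak_deriv i f x * (deriv ^^ j) \<phi> x)
      = (-1) ^ i * ((-1) ^ j * (LINT x:{0..2*pi}|lborel. weak_deriv (i + j) f x * \<phi> x))"
    using i[unfolded has_weak_deriv_def, rule_format, OF smooth_periodic_deriv[OF \<phi>, of j]]
      ij[unfolded has_weak_deriv_def, rule_format, OF \<phi>]
    by (simp add: funpow_add power_add)
  then show "(LINT x:{0..2*pi}|lborel. weak_deriv i f x * (deriv ^^ j) \<phi> x) =
      (-1) ^ j * (LINT x:{0..2*pi}|lborel. weak_deriv (i + j) f x * \<phi> x)"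
    by simp
qed

lemma has_weak_deriv_0: "has_weak_deriv 0 f f"
  by (simp add: has_weak_deriv_def)

lemma L2_zero: "(\<lambda>_. 0) \<in> L2_periodic"
  by (intro L2_continuous) (auto simp: periodic_fun_simple_def)

lemma sobolev_zero: "(\<lambda>_. 0) \<in> sobolev_periodic k"
  using L2_zero by (auto simp: sobolev_periodic_def has_weak_deriv_def intro!: bexI[OF _ L2_zero])

subsection \<open>The Hilbert space \<open>H\<^sup>3\<close> of odd functions\<close>

text \<open>Every class in \<open>H\<^sup>3\<close> contains exactly one continuous function, which serves as its
  representative. A sine series expansion means that the function is odd.\<close>

typedef h3_odd = "{f \<in> sobolev_periodic 3. continuous_on UNIV f \<and> (\<forall>x. f (-x) = - f x)}"
  morphisms h3_fun Abs_h3_odd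
  by (rule exI[of _ "\<lambda>_. 0"]) (simp add: sobolev_zero)

lemma h3_fun_props:
  "h3_fun f \<in> sobolev_periodic 3" "continuous_on UNIV (h3_fun f)" "h3_fun f (-x) = - h3_fun f x"
  "h3_fun f \<in> L2_periodic"
  using h3_fun[of f] sobolev_L2 by auto

lemma h3_comb:
  "h3_fun (Abs_h3_odd (\<lambda>x. a * h3_fun f x + b * h3_fun g x)) = (\<lambda>x. a * h3_fun f x + b * h3_fun g x)"
  by (rule Abs_h3_odd_inverse)
     (auto intro!: sobolev_comb continuous_intros h3_fun_props simp: h3_fun_props(3))

instantiation h3_odd :: real_inner
begin

definition "0 = Abs_h3_odd (\<lambda>_. 0)"
definition "f + g = Abs_h3_odd (\<lambda>x. 1 * h3_fun f x + 1 * h3_fun g x)"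
definition "f - g = Abs_h3_odd (\<lambda>x. 1 * h3_fun f x + (-1) * h3_fun g x)"
definition "- f = Abs_h3_odd (\<lambda>x. (-1) * h3_fun f x + 0 * h3_fun f x)"
definition "c *\<^sub>R f = Abs_h3_odd (\<lambda>x. c * h3_fun f x + 0 * h3_fun f x)"
definition "inner f g = (\<Sum>j\<le>3. LINT x:{0..2*pi}|lborel.
  weak_deriv j (h3_fun f) x * weak_deriv j (h3_fun g) x)"
definition "norm (f::h3_odd) = sqrt (inner f f)"
definition "sgn (f::h3_odd) = scaleR (inverse (norm f)) f"
definition "dist f (g::h3_odd) = norm (f - g)"
definition
  "(uniformity :: (h3_odd \<times> h3_odd) filter) = (INF e\<in>{0<..}. principal {(x, y). dist x y < e})"
definition
  "open (U :: h3_odd set) \<longleftrightarrow> (\<forall>x\<in>U. eventually (\<lambda>(x', y). x' = x \<longrightarrow> y \<in> U) uniformity)"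

lemma h3_fun_zero: "h3_fun 0 = (\<lambda>_. 0)"
  unfolding zero_h3_odd_def by (rule Abs_h3_odd_inverse) (simp add: sobolev_zero)

lemma h3_fun_plus: "h3_fun (f + g) = (\<lambda>x. h3_fun f x + h3_fun g x)"
  unfolding plus_h3_odd_def h3_comb by simp

lemma h3_fun_minus: "h3_fun (f - g) = (\<lambda>x. h3_fun f x - h3_fun g x)"
  unfolding minus_h3_odd_def h3_comb by simp

lemma h3_fun_uminus: "h3_fun (- f) = (\<lambda>x. - h3_fun f x)"
  unfolding uminus_h3_odd_def h3_comb by simp

lemma h3_fun_scaleR: "h3_fun (c *\<^sub>R f) = (\<lambda>x. c * h3_fun f x)"
  unfolding scaleR_h3_odd_def h3_comb by simp

lemma inner_h3_comb:
  assumes "h3_fun h = (\<lambda>x. a * h3_fun f x + b * h3_fun g x)"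
  shows "inner h k = a * inner f k + b * inner g (k::h3_odd)"
proof -
  have "(LINT x:{0..2*pi}|lborel. weak_deriv j (h3_fun h) x * weak_deriv j (h3_fun k) x)
      = a * (LINT x:{0..2*pi}|lborel. weak_deriv j (h3_fun f) x * weak_deriv j (h3_fun k) x)
      + b * (LINT x:{0..2*pi}|lborel. weak_deriv j (h3_fun g) x * weak_deriv j (h3_fun k) x)"
    (is "?l = ?r") if "j \<le> 3" for j
  proof -
    have L: "weak_deriv j (h3_fun u) \<in> L2_periodic" for u
      using weak_deriv_sobolev(1)[OF h3_fun_props(1) that] .
    note [measurable] = L2_periodicD(1)[OF L]
    have "?l = (LINT x:{0..2*pi}|lborel.
        (a * weak_deriv j (h3_fun f) x + b * weak_deriv j (h3_fun g) x) * weak_deriv j (h3_fun k) x)"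
      using sobolev_comb(2)[OF h3_fun_props(1)[of f] h3_fun_props(1)[of g] that, of a b]
      unfolding assms[symmetric]
      by (intro set_lebesgue_integral_cong_AE) (auto elim: eventually_mono)
    also have "\<dots> = ?r"
      using L2_mult_integrable[OF L L]
      by (simp add: distrib_right mult.assoc set_integral_add)
    finally show ?thesis .
  qed
  then show ?thesis
    unfolding inner_h3_odd_def by (simp add: sum.distrib sum_distrib_left)
qed

instance
proof
  fix f g h :: h3_odd and a b :: real
  show "f + g + h = f + (g + h)" "f + g = g + f" "0 + f = f" "- f + f = 0" "f - g = f + - g"
    "a *\<^sub>R (f + g) = a *\<^sub>R f + a *\<^sub>R g" "(a + b) *\<^sub>R f = a *\<^sub>R f + b *\<^sub>R f"
    "a *\<^sub>R b *\<^sub>R f = (a * b) *\<^sub>R f" "1 *\<^sub>R f = f"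
    by (simp_all add: h3_fun_inject[symmetric] h3_fun_zero h3_fun_plus h3_fun_minus h3_fun_uminus
        h3_fun_scaleR algebra_simps)
  show "inner f g = inner g f"
    by (simp add: inner_h3_odd_def mult.commute)
  show "inner (f + g) h = inner f h + inner g h"
    using inner_h3_comb[of "f + g" 1 f 1 g h] by (simp add: h3_fun_plus)
  show "inner (a *\<^sub>R f) g = a * inner f g"
    using inner_h3_comb[of "a *\<^sub>R f" a f 0 f g] by (simp add: h3_fun_scaleR)
  have nonneg: "0 \<le> (LINT x:{0..2*pi}|lborel. weak_deriv j (h3_fun f) x * weak_deriv j (h3_fun f) x)" for j
    unfolding set_lebesgue_integral_def by (intro Bochner_Integration.integral_nonneg) simp
  show "0 \<le> inner f f"
    unfolding inner_h3_odd_def by (intro sum_nonneg nonneg)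
  show "inner f f = 0 \<longleftrightarrow> f = 0"
  proof
    assume "f = 0"
    then show "inner f f = 0"
      using inner_h3_comb[of f 0 f 0 f f] by (simp add: h3_fun_zero)
  next
    assume "inner f f = 0"
    then have z: "(LINT x:{0..2*pi}|lborel. weak_deriv 0 (h3_fun f) x * weak_deriv 0 (h3_fun f) x) = 0"
      unfolding inner_h3_odd_def using nonneg by (subst (asm) sum_nonneg_eq_0_iff) auto
    let ?u = "h3_fun f" and ?w = "weak_deriv 0 (h3_fun f)"
    have w: "?w \<in> L2_periodic" using weak_deriv_sobolev(1)[OF h3_fun_props(1)] by simp
    have "AE x in lborel. indicator {0..2*pi} x *\<^sub>R (?w x * ?w x) = 0"
      using z L2_mult_integrable[OF w w] unfolding set_lebesgue_integral_def set_integrable_def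
      by (subst integral_nonneg_eq_0_iff_AE[symmetric]) auto
    then have "AE x in lborel. x \<in> {0<..<2*pi} \<longrightarrow> ?w x = 0"
      by eventually_elim (auto simp: indicator_def)
    then have "AE x in lborel. ?w x = 0"
      by (rule AE_periodic[OF _ L2_periodicD(2,1)[OF w]])
    with weak_deriv_eqI[OF h3_fun_props(4) h3_fun_props(4) has_weak_deriv_0, of f]
    have "AE x in lborel. ?u x = 0" by eventually_elim simp
    then have "{x. ?u x \<noteq> 0} \<in> null_sets lborel"
      using h3_fun_props(4)[of f, THEN L2_periodicD(1)]
      by (subst (asm) AE_iff_null) auto
    moreover have "open {x. ?u x \<noteq> 0}"
      using h3_fun_props(2)[of f] by (intro open_Collect_neq) auto
    ultimately have "{x. ?u x \<noteq> 0} = {}"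
      using open_not_negligible null_sets_completionI negligible_iff_null_sets by metis
    then show "f = 0"
      by (auto simp: h3_fun_inject[symmetric] h3_fun_zero)
  qed
qed (simp_all add: norm_h3_odd_def sgn_h3_odd_def dist_h3_odd_def uniformity_h3_odd_def open_h3_odd_def)

end

section \<open>The coordinate-free flame front model\<close>

definition cos_integral :: "h3_odd \<Rightarrow> real" where
  "cos_integral \<theta> = (LINT \<sigma>:{0..2*pi}|lborel. cos (h3_fun \<theta> \<sigma>))"

definition s_sigma :: "h3_odd \<Rightarrow> real" where
  "s_sigma \<theta> = 2*pi / cos_integral \<theta>"

definition arclength_deriv :: "nat \<Rightarrow> h3_odd \<Rightarrow> (real \<Rightarrow> real) \<Rightarrow> real \<Rightarrow> real" where
  "arclength_deriv n \<theta> f \<sigma> = weak_deriv n f \<sigma> / s_sigma \<theta> ^ n"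

definition curvature :: "h3_odd \<Rightarrow> real \<Rightarrow> real" where
  "curvature \<theta> = arclength_deriv 1 \<theta> (h3_fun \<theta>)"

definition flame_normal_velocity :: "real \<Rightarrow> h3_odd \<Rightarrow> real \<Rightarrow> real" where
  "flame_normal_velocity \<alpha> \<theta> \<sigma> =
     - (1 + (\<alpha> - 1) * curvature \<theta> \<sigma> + 4 * arclength_deriv 2 \<theta> (curvature \<theta>) \<sigma>)"

text \<open>A horizontally periodic front \<open>(x, y)\<close> (functions of \<open>\<sigma>\<close> and \<open>t\<close>), parameterized by
  normalized arclength, with tangent angle \<open>\<theta> t\<close> at time \<open>t\<close>, normal velocity \<open>U\<close> and
  tangential velocity \<open>V\<close>. The law for \<open>U\<close> is an identity in \<open>L\<^sup>2\<close>.\<close>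

definition flame_front_motion ::
  "real \<Rightarrow> (real \<Rightarrow> h3_odd) \<Rightarrow> (real \<Rightarrow> real \<Rightarrow> real) \<Rightarrow> (real \<Rightarrow> real \<Rightarrow> real) \<Rightarrow>
   (real \<Rightarrow> real \<Rightarrow> real) \<Rightarrow> (real \<Rightarrow> real \<Rightarrow> real) \<Rightarrow> bool" where
  "flame_front_motion \<alpha> \<theta> x y U V \<longleftrightarrow>
     (\<forall>\<sigma> t. x (\<sigma> + 2*pi) t = x \<sigma> t + 2*pi \<and> y (\<sigma> + 2*pi) t = y \<sigma> t) \<and>
     (\<forall>t. 0 < cos_integral (\<theta> t)) \<and>
     (\<forall>\<sigma> t. ((\<lambda>\<sigma>. x \<sigma> t) has_real_derivative s_sigma (\<theta> t) * cos (h3_fun (\<theta> t) \<sigma>)) (at \<sigma>) \<and>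
            ((\<lambda>\<sigma>. y \<sigma> t) has_real_derivative s_sigma (\<theta> t) * sin (h3_fun (\<theta> t) \<sigma>)) (at \<sigma>)) \<and>
     (\<forall>\<sigma> t. ((\<lambda>t. x \<sigma> t) has_real_derivative
               - U \<sigma> t * sin (h3_fun (\<theta> t) \<sigma>) + V \<sigma> t * cos (h3_fun (\<theta> t) \<sigma>)) (at t) \<and>
            ((\<lambda>t. y \<sigma> t) has_real_derivative
               U \<sigma> t * cos (h3_fun (\<theta> t) \<sigma>) + V \<sigma> t * sin (h3_fun (\<theta> t) \<sigma>)) (at t)) \<and>
     (\<forall>t. AE \<sigma> in lborel. U \<sigma> t = flame_normal_velocity \<alpha> (\<theta> t) \<sigma>)"

text \<open>With these velocities \<open>(x\<^sub>t, y\<^sub>t) = (0, -\<beta>)\<close>, so the tangent angle is constant in time.\<close>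

definition vertically_traveling :: "h3_odd \<Rightarrow> real \<Rightarrow> real \<Rightarrow> bool" where
  "vertically_traveling \<theta> \<beta> \<alpha> \<longleftrightarrow>
     (\<exists>x y. flame_front_motion \<alpha> (\<lambda>_. \<theta>) x y
        (\<lambda>\<sigma> t. - \<beta> * cos (h3_fun \<theta> \<sigma>)) (\<lambda>\<sigma> t. - \<beta> * sin (h3_fun \<theta> \<sigma>)))"

definition flame_G :: "h3_odd \<Rightarrow> real \<Rightarrow> real \<Rightarrow> real \<Rightarrow> real" where
  "flame_G \<theta> \<beta> \<alpha> \<sigma> =
     1 + (\<alpha> - 1) * weak_deriv 1 (h3_fun \<theta>) \<sigma> / s_sigma \<theta>
       + 4 * weak_deriv 3 (h3_fun \<theta>) \<sigma> / s_sigma \<theta> ^ 3 - \<beta> * cos (h3_fun \<theta> \<sigma>)"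

text \<open>\<open>G = 0\<close> expresses \<open>U = -\<beta> cos \<theta>\<close> for the normal velocity of the model.\<close>

lemma flame_G_eq:
  "AE \<sigma> in lborel. flame_G \<theta> \<beta> \<alpha> \<sigma> = - flame_normal_velocity \<alpha> \<theta> \<sigma> - \<beta> * cos (h3_fun \<theta> \<sigma>)"
proof -
  let ?u = "h3_fun \<theta>" and ?c = "1 / s_sigma \<theta>"
  have L: "weak_deriv j ?u \<in> L2_periodic" if "j \<le> 3" for j
    using weak_deriv_sobolev(1)[OF h3_fun_props(1) that] .
  have "has_weak_deriv 2 (weak_deriv 1 ?u) (weak_deriv 3 ?u)"
    using weak_deriv_weak_deriv[OF h3_fun_props(1)[of \<theta>], of 1 2] by (simp add: numeral_3_eq_3)
  then have "has_weak_deriv 2 (\<lambda>x. ?c * weak_deriv 1 ?u x + 0 * weak_deriv 1 ?u x)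
      (\<lambda>x. ?c * weak_deriv 3 ?u x + 0 * weak_deriv 3 ?u x)"
    by (intro has_weak_deriv_comb L) auto
  then have "has_weak_deriv 2 (curvature \<theta>) (\<lambda>x. ?c * weak_deriv 3 ?u x)"
    by (simp add: curvature_def arclength_deriv_def[abs_def])
  moreover have "curvature \<theta> \<in> L2_periodic"
    using L2_cmult[OF L, of 1 ?c] by (simp add: curvature_def arclength_deriv_def[abs_def])
  ultimately have "AE \<sigma> in lborel. weak_deriv 2 (curvature \<theta>) \<sigma> = ?c * weak_deriv 3 ?u \<sigma>"
    using L2_cmult[OF L, of 3 ?c] by (intro weak_deriv_eqI) auto
  then show ?thesis
    by eventually_elim
      (simp add: flame_G_def flame_normal_velocity_def curvature_def arclength_deriv_def
        power2_eq_square power3_eq_cube)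
qed

definition trivial_solutions :: "(h3_odd \<times> real \<times> real) set" where
  "trivial_solutions = {(\<theta>, \<beta>, \<alpha>). \<theta> = 0 \<and> \<beta> = 1}"

lemma flame_G_trivial:
  assumes "(\<theta>, \<beta>, \<alpha>) \<in> trivial_solutions"
  shows "AE \<sigma> in lborel. flame_G \<theta> \<beta> \<alpha> \<sigma> = 0"
proof -
  have "AE \<sigma> in lborel. weak_deriv n (\<lambda>_. 0) \<sigma> = 0" for n
    by (rule weak_deriv_eqI) (auto simp: L2_zero has_weak_deriv_def)
  from this[of 1] this[of 3] show ?thesis
    by eventually_elim (use assms in \<open>simp add: flame_G_def trivial_solutions_def h3_fun_zero\<close>)
qed

end

theory Submission
  imports Defs
begin

text \<open>Integrating \<open>G = 0\<close> over a period forces \<open>s\<^sub>\<sigma> = \<beta>\<close>, so the problem is the equation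
  \<open>\<theta>''' + \<mu> \<theta>' + \<beta>\<^sup>3/4 (1 - \<beta> cos \<theta>) = 0\<close> with \<open>\<mu> = (\<alpha> - 1) \<beta>\<^sup>2/4\<close>. Blow up at the
  bifurcation point by \<open>\<theta> = w \<phi>\<close>, \<open>\<phi>'(0) = k\<close>, \<open>\<beta> = 1 + w\<^sup>2 b\<close>, \<open>\<mu> = k\<^sup>2 + w m\<close>. Variation of
  constants expresses \<open>\<phi>\<close> through the forcing \<open>w f = \<phi>''' + k\<^sup>2 \<phi>'\<close>, and the two solvability
  conditions for a periodic response determine \<open>b\<close> and \<open>m\<close>. If \<open>cos \<theta> = 1 - w\<^sup>2 d\<close> and
  \<open>sin \<theta> = w S\<close> are replaced by the differential equations that characterize them, the result
  is a fixed point equation \<open>x = \<Phi> (x, w)\<close> in a Banach space of functions on \<open>[0, \<pi>]\<close>, with \<open>\<Phi>\<close>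
  built from bounded multilinear maps and \<open>\<Phi> (\<cdot>, 0)\<close> constant. Contraction gives a solution
  near \<open>w = 0\<close> that is \<open>C\<^sup>1\<close> in \<open>w\<close>, and even periodic extension of \<open>f\<close> turns it into a
  \<open>C\<^sup>1\<close> curve in \<open>H\<^sup>3\<close>.\<close>

section \<open>Fixed points depending on a parameter\<close>

text \<open>Differentiability is required on the whole space, with a derivative continuous in
  operator norm. The maps treated here are built from constants and bounded multilinear maps, so no
  domains have to be tracked.\<close>

definition C1_map :: "('a::real_normed_vector \<Rightarrow> 'b::real_normed_vector) \<Rightarrow> bool" where
  "C1_map f \<longleftrightarrow> (\<exists>D :: 'a \<Rightarrow> 'a \<Rightarrow>\<^sub>L 'b.
     (\<forall>x. (f has_derivative blinfun_apply (D x)) (at x)) \<and> continuous_on UNIV D)"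

lemma C1_map_const: "C1_map (\<lambda>_. c)"
  unfolding C1_map_def
  by (rule exI[of _ "\<lambda>_. 0"]) (auto simp: zero_blinfun.rep_eq[abs_def] intro!: continuous_intros)

lemma C1_map_bounded_linear:
  assumes L: "bounded_linear L" and f: "C1_map f"
  shows "C1_map (\<lambda>x. L (f x))"
proof -
  obtain D where D: "\<And>x. (f has_derivative blinfun_apply (D x)) (at x)" "continuous_on UNIV D"
    using f by (auto simp: C1_map_def)
  show ?thesis
    unfolding C1_map_def
  proof (intro exI[of _ "\<lambda>x. Blinfun L o\<^sub>L D x"] conjI allI)
    show "((\<lambda>x. L (f x)) has_derivative blinfun_apply (Blinfun L o\<^sub>L D x)) (at x)" for x
      using bounded_linear.has_derivative[OF L D(1), of x]
      by (simp add: bounded_linear_Blinfun_apply[OF L] comp_def blinfun_compose.rep_eq)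
    show "continuous_on UNIV (\<lambda>x. Blinfun L o\<^sub>L D x)"
      by (intro continuous_intros D)
  qed
qed

lemma C1_map_fst: "C1_map f \<Longrightarrow> C1_map (\<lambda>x. fst (f x))"
  and C1_map_snd: "C1_map f \<Longrightarrow> C1_map (\<lambda>x. snd (f x))"
  using C1_map_bounded_linear[OF bounded_linear_fst] C1_map_bounded_linear[OF bounded_linear_snd]
  by blast+

lemma C1_map_ident: "C1_map (\<lambda>x. x)"
  unfolding C1_map_def
  by (rule exI[of _ "\<lambda>_. id_blinfun"]) (auto intro!: continuous_intros simp: id_blinfun.rep_eq)

lemma C1_map_bilinear:
  assumes B: "bounded_bilinear B" and f: "C1_map f" and g: "C1_map g"
  shows "C1_map (\<lambda>x. B (f x) (g x))"
proof -
  interpret bounded_bilinear B by (rule B)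
  obtain D where D: "\<And>x. (f has_derivative blinfun_apply (D x)) (at x)" "continuous_on UNIV D"
    using f by (auto simp: C1_map_def)
  obtain E where E: "\<And>x. (g has_derivative blinfun_apply (E x)) (at x)" "continuous_on UNIV E"
    using g by (auto simp: C1_map_def)
  have cont: "continuous_on UNIV f" "continuous_on UNIV g"
    using D(1) E(1) by (auto intro!: has_derivative_continuous continuous_at_imp_continuous_on)
  show ?thesis
    unfolding C1_map_def
  proof (intro exI[of _ "\<lambda>x. (prod_right (f x) o\<^sub>L E x) + (prod_left (g x) o\<^sub>L D x)"] conjI allI)
    show "((\<lambda>x. B (f x) (g x)) has_derivative
        blinfun_apply ((prod_right (f x) o\<^sub>L E x) + (prod_left (g x) o\<^sub>L D x))) (at x)" for x
      using FDERIV[OF D(1) E(1), of x]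
      by (simp add: blinfun.add_left[abs_def] prod_left.rep_eq prod_right.rep_eq plus_blinfun.rep_eq)
    show "continuous_on UNIV (\<lambda>x. (prod_right (f x) o\<^sub>L E x) + (prod_left (g x) o\<^sub>L D x))"
      by (intro continuous_intros D E cont bounded_linear.continuous_on[OF bounded_linear_prod_left]
          bounded_linear.continuous_on[OF bounded_linear_prod_right])
  qed
qed

lemma C1_map_add:
  assumes f: "C1_map f" and g: "C1_map g"
  shows "C1_map (\<lambda>x. f x + g x)"
proof -
  obtain D where D: "\<And>x. (f has_derivative blinfun_apply (D x)) (at x)" "continuous_on UNIV D"
    using f by (auto simp: C1_map_def)
  obtain E where E: "\<And>x. (g has_derivative blinfun_apply (E x)) (at x)" "continuous_on UNIV E"
    using g by (auto simp: C1_map_def)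
  show ?thesis
    unfolding C1_map_def
    by (intro exI[of _ "\<lambda>x. D x + E x"] conjI allI continuous_intros D E)
      (use has_derivative_add[OF D(1) E(1)] in \<open>simp add: plus_blinfun.rep_eq\<close>)
qed

lemma C1_map_Pair:
  assumes f: "C1_map f" and g: "C1_map g"
  shows "C1_map (\<lambda>x. (f x, g x))"
proof -
  have "bounded_linear (\<lambda>x. (x, 0))" "bounded_linear (\<lambda>x. (0, x))"
    by (intro bounded_linear_Pair bounded_linear_ident bounded_linear_zero)+
  from C1_map_add[OF C1_map_bounded_linear[OF this(1) f] C1_map_bounded_linear[OF this(2) g]]
  show ?thesis by simp
qed

lemma C1_map_mult: "C1_map f \<Longrightarrow> C1_map g \<Longrightarrow> C1_map (\<lambda>x. f x * g x :: real)"
  by (rule C1_map_bilinear[OF bounded_bilinear_mult])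

lemma C1_map_scaleR: "C1_map f \<Longrightarrow> C1_map g \<Longrightarrow> C1_map (\<lambda>x. f x *\<^sub>R g x)"
  by (rule C1_map_bilinear[OF bounded_bilinear_scaleR])

lemma C1_map_minus: "C1_map f \<Longrightarrow> C1_map (\<lambda>x. - f x)"
  using C1_map_bounded_linear[OF bounded_linear_minus[OF bounded_linear_ident]] .

lemma C1_map_diff: "C1_map f \<Longrightarrow> C1_map g \<Longrightarrow> C1_map (\<lambda>x. f x - g x)"
  using C1_map_add[OF _ C1_map_minus] by simp

lemma C1_map_power: "C1_map f \<Longrightarrow> C1_map (\<lambda>x. f x ^ n :: real)"
  by (induction n) (auto intro: C1_map_const C1_map_mult)

lemmas C1_map_intros = C1_map_const C1_map_fst C1_map_snd C1_map_ident C1_map_add C1_map_diff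
  C1_map_minus C1_map_Pair C1_map_mult C1_map_scaleR C1_map_power

text \<open>Since \<open>\<Phi> (\<cdot>, 0)\<close> is constant, the partial derivative in the
  first variable vanishes at \<open>(x0, 0)\<close>. Near this point
  \<open>\<Phi> (\<cdot>, t)\<close> is therefore a contraction with constant 1/2, uniformly in
  \<open>t\<close>, and Banach's theorem yields \<open>x t\<close>. The same contraction bound gives
  first the Lipschitz estimate, then the derivative, then its continuity.\<close>

lemma C1_fixed_point_curve:
  fixes \<Phi> :: "'a::banach \<times> real \<Rightarrow> 'a"
  assumes \<Phi>: "C1_map \<Phi>" and \<Phi>0: "\<And>x. \<Phi> (x, 0) = x0"
  obtains \<delta> x where "\<delta> > 0" "x 0 = x0" "\<And>t. \<bar>t\<bar> < \<delta> \<Longrightarrow> x t = \<Phi> (x t, t)"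
    "x C1_differentiable_on {-\<delta><..<\<delta>}"
proof -
  obtain D where D: "\<And>z. (\<Phi> has_derivative blinfun_apply (D z)) (at z)" and contD: "continuous_on UNIV D"
    using \<Phi> by (auto simp: C1_map_def)
  have D0: "D (x0, 0) (v, 0) = 0" for v
  proof -
    have "((\<lambda>y. \<Phi> (y, 0)) has_derivative (\<lambda>v. D (x0, 0) (v, 0))) (at x0)"
      by (rule has_derivative_compose[OF has_derivative_Pair[OF has_derivative_ident has_derivative_const] D])
    moreover have "((\<lambda>y. \<Phi> (y, 0)) has_derivative (\<lambda>v. 0)) (at x0)"
      using \<Phi>0 by simp
    ultimately show ?thesis by (metis has_derivative_unique)
  qed
  obtain r where r: "r > 0" "\<And>z. dist z (x0, 0) < r \<Longrightarrow> norm (D z - D (x0, 0)) < 1/2"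
  proof -
    have "isCont D (x0, 0)" using contD by (simp add: continuous_on_eq_continuous_at)
    then show ?thesis
      using that unfolding continuous_at_eps_delta by (auto simp: dist_norm dest!: spec[of _ "1/2"])
  qed
  define M where "M = norm (D (x0, 0)) + 1"
  have M: "norm (D z) \<le> M" if "dist z (x0, 0) < r" for z
    using r(2)[OF that] norm_triangle_sub[of "D z" "D (x0, 0)"] by (simp add: M_def)
  have M1: "M \<ge> 1" by (simp add: M_def)
  have half: "norm (D z (v, 0)) \<le> 1/2 * norm v" if "dist z (x0, 0) < r" for z v
  proof -
    have "norm (D z (v, 0)) = norm ((D z - D (x0, 0)) (v, 0))"
      by (simp add: blinfun.diff_left D0)
    also have "\<dots> \<le> norm (D z - D (x0, 0)) * norm (v, 0::real)" by (rule norm_blinfun)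
    also have "\<dots> \<le> 1/2 * norm v"
      using r(2)[OF that] by (intro mult_mono) (auto simp: norm_Pair)
    finally show ?thesis .
  qed
  \<comment> \<open>Half of \<open>r\<close>, because a distance in the product is at most the sum
    of the distances of the components.\<close>
  define \<rho> where "\<rho> = r / 2"
  have \<rho>: "\<rho> > 0" using r by (simp add: \<rho>_def)
  \<comment> \<open>The center moves by less than \<open>\<rho> / 2\<close>, and the contraction
    contributes at most another \<open>\<rho> / 2\<close>; so the ball of radius
    \<open>\<rho>\<close> is mapped into itself.\<close>
  obtain \<delta> where \<delta>: "\<delta> > 0" "\<delta> \<le> \<rho>" "\<And>t. \<bar>t\<bar> < \<delta> \<Longrightarrow> norm (\<Phi> (x0, t) - x0) < \<rho> / 2"
  proof -
    have "isCont \<Phi> (x0, 0)" using D has_derivative_continuous by blast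
    then obtain d where d: "d > 0" "\<And>z. dist z (x0, 0) < d \<Longrightarrow> dist (\<Phi> z) (\<Phi> (x0, 0)) < \<rho> / 2"
      unfolding continuous_at_eps_delta using \<rho> by (auto dest!: spec[of _ "\<rho> / 2"])
    show ?thesis
      by (rule that[of "min d \<rho>"]) (use d \<rho> \<Phi>0 in \<open>auto simp: dist_norm norm_Pair\<close>)
  qed
  have near: "dist (y, t) (x0, 0) < r" if "y \<in> cball x0 \<rho>" "\<bar>t\<bar> < \<delta>" for y t
  proof -
    have "dist (y, t) (x0, 0) \<le> dist y x0 + \<bar>t\<bar>"
      using norm_Pair_le[of "y - x0" t] by (simp add: dist_norm)
    then show ?thesis using that \<delta>(2) by (simp add: \<rho>_def dist_commute)
  qed
  have contr: "norm (\<Phi> (y, t) - \<Phi> (y', t)) \<le> 1/2 * norm (y - y')"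
    if "y \<in> cball x0 \<rho>" "y' \<in> cball x0 \<rho>" "\<bar>t\<bar> < \<delta>" for y y' t
  proof (rule differentiable_bound[of "cball x0 \<rho>" "\<lambda>y. \<Phi> (y, t)" "\<lambda>y v. D (y, t) (v, 0)"])
    show "((\<lambda>y. \<Phi> (y, t)) has_derivative (\<lambda>v. D (y, t) (v, 0))) (at y within cball x0 \<rho>)" for y
      by (rule has_derivative_compose[OF has_derivative_Pair[OF has_derivative_ident has_derivative_const] D])
    show "onorm (\<lambda>v. D (y, t) (v, 0)) \<le> 1/2" if "y \<in> cball x0 \<rho>" for y
      by (intro onorm_bound half near that \<open>\<bar>t\<bar> < \<delta>\<close>) simp
  qed (use that in auto)
  have "\<exists>!y. y \<in> cball x0 \<rho> \<and> \<Phi> (y, t) = y" if t: "\<bar>t\<bar> < \<delta>" for t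
  proof (rule Banach_fix[where c="1/2"])
    show "(\<lambda>y. \<Phi> (y, t)) ` cball x0 \<rho> \<subseteq> cball x0 \<rho>"
    proof clarify
      fix y assume y: "y \<in> cball x0 \<rho>"
      have "norm (\<Phi> (y, t) - x0) \<le> norm (\<Phi> (y, t) - \<Phi> (x0, t)) + norm (\<Phi> (x0, t) - x0)"
        using norm_triangle_ineq[of "\<Phi> (y, t) - \<Phi> (x0, t)" "\<Phi> (x0, t) - x0"] by simp
      also have "\<dots> \<le> 1/2 * norm (y - x0) + \<rho> / 2"
        using contr[OF y _ t, of x0] \<delta>(3)[OF t] \<rho> by (intro add_mono) auto
      also have "\<dots> \<le> \<rho>" using y by (simp add: dist_norm norm_minus_commute)
      finally show "\<Phi> (y, t) \<in> cball x0 \<rho>" by (simp add: dist_norm norm_minus_commute)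
    qed
  qed (use contr t \<rho> in \<open>auto simp: dist_norm complete_eq_closed\<close>)
  then obtain x where x: "\<And>t. \<bar>t\<bar> < \<delta> \<Longrightarrow> x t \<in> cball x0 \<rho>" "\<And>t. \<bar>t\<bar> < \<delta> \<Longrightarrow> \<Phi> (x t, t) = x t"
    by metis
  have x0: "x 0 = x0" using x(2)[of 0] \<delta>(1) \<Phi>0 by simp
  \<comment> \<open>The change in \<open>t\<close> costs \<open>M * \<bar>t - s\<bar>\<close>. The
    change in the first variable is at most half of the left side and is absorbed there, which
    doubles the constant.\<close>
  have lip: "norm (x t - x s) \<le> 2 * M * \<bar>t - s\<bar>" if "\<bar>t\<bar> < \<delta>" "\<bar>s\<bar> < \<delta>" for t s
  proof -
    have "norm (\<Phi> (x s, t) - \<Phi> (x s, s)) \<le> M * norm (t - s)"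
    proof (rule differentiable_bound[of "{-\<delta><..<\<delta>}" "\<lambda>t. \<Phi> (x s, t)" "\<lambda>t \<tau>. D (x s, t) (0, \<tau>)"])
      show "((\<lambda>t. \<Phi> (x s, t)) has_derivative (\<lambda>\<tau>. D (x s, t) (0, \<tau>))) (at t within {-\<delta><..<\<delta>})" for t
        by (rule has_derivative_compose[OF has_derivative_Pair[OF has_derivative_const has_derivative_ident] D])
      show "onorm (\<lambda>\<tau>. D (x s, t) (0, \<tau>)) \<le> M" if "t \<in> {-\<delta><..<\<delta>}" for t
      proof (rule onorm_bound)
        show "0 \<le> M" using M1 by simp
        fix \<tau> :: real
        have "norm (D (x s, t) (0, \<tau>)) \<le> norm (D (x s, t)) * norm (0::'a, \<tau>)" by (rule norm_blinfun)
        also have "\<dots> \<le> M * norm \<tau>"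
          using M[OF near[OF x(1)[OF \<open>\<bar>s\<bar> < \<delta>\<close>]], of t] that by (intro mult_mono) (auto simp: norm_Pair M_def)
        finally show "norm (D (x s, t) (0, \<tau>)) \<le> M * norm \<tau>" .
      qed
    qed (use that in auto)
    moreover have "norm (\<Phi> (x t, t) - \<Phi> (x s, t)) \<le> 1/2 * norm (x t - x s)"
      using that by (intro contr x)
    moreover have "x t - x s = (\<Phi> (x t, t) - \<Phi> (x s, t)) + (\<Phi> (x s, t) - \<Phi> (x s, s))"
      using x(2) that by simp
    then have "norm (x t - x s) \<le> norm (\<Phi> (x t, t) - \<Phi> (x s, t)) + norm (\<Phi> (x s, t) - \<Phi> (x s, s))"
      by (simp only: norm_triangle_ineq)
    ultimately show ?thesis by (simp only: real_norm_def)
  qed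
  \<comment> \<open>Formal differentiation of \<open>x t = \<Phi> (x t, t)\<close> says that the
    velocity is a fixed point of this affine map, again a contraction with constant 1/2.\<close>
  have "\<exists>v. D (x t, t) (v, 1) = v" if "\<bar>t\<bar> < \<delta>" for t
  proof -
    have "\<exists>!v. v \<in> UNIV \<and> D (x t, t) (v, 1) = v"
    proof (rule Banach_fix[where c="1/2"])
      show "dist (D (x t, t) (u, 1)) (D (x t, t) (v, 1)) \<le> 1/2 * dist u v" for u v
        using half[OF near[OF x(1)[OF that] that], of "u - v"]
        by (simp add: dist_norm blinfun.diff_right[symmetric])
    qed (auto simp: complete_UNIV)
    then show ?thesis by blast
  qed
  then obtain v where v: "\<And>t. \<bar>t\<bar> < \<delta> \<Longrightarrow> D (x t, t) (v t, 1) = v t" by metis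
  have "(x has_vector_derivative v s) (at s)" if s: "\<bar>s\<bar> < \<delta>" for s
    unfolding has_vector_derivative_def has_derivative_at_alt
  proof (intro conjI allI impI)
    show "bounded_linear (\<lambda>h. h *\<^sub>R v s)" by (rule bounded_linear_scaleR_left)
    fix e :: real assume e: "e > 0"
    \<comment> \<open>The factor \<open>2 * M + 1\<close> is the Lipschitz constant of the curve
      \<open>(x t, t)\<close>; the other factor 2 comes from absorbing the contraction term.\<close>
    define e' where "e' = e / (2 * (2 * M + 1))"
    have e': "e' > 0" using e M1 by (simp add: e'_def)
    obtain d where d: "d > 0" "\<And>z. norm (z - (x s, s)) < d \<Longrightarrow>
        norm (\<Phi> z - \<Phi> (x s, s) - D (x s, s) (z - (x s, s))) \<le> e' * norm (z - (x s, s))"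
      using D[of "(x s, s)", unfolded has_derivative_at_alt, THEN conjunct2, rule_format, OF e'] by blast
    define d' where "d' = min (d / (2 * M + 1)) (\<delta> - \<bar>s\<bar>)"
    have "d' > 0" using d(1) M1 s by (simp add: d'_def)
    moreover have "norm (x t - x s - (t - s) *\<^sub>R v s) \<le> e * norm (t - s)" if "norm (t - s) < d'" for t
    proof -
      have t: "\<bar>t\<bar> < \<delta>" using that by (auto simp: d'_def)
      define h where "h = x t - x s"
      have n: "norm (h, t - s) \<le> (2 * M + 1) * \<bar>t - s\<bar>"
      proof -
        have "norm (h, t - s) \<le> norm h + \<bar>t - s\<bar>"
          using norm_Pair_le[of h "t - s"] by simp
        then show ?thesis using lip[OF t s] by (simp add: h_def algebra_simps)
      qed
      also have "\<dots> < d" using that M1 by (simp add: d'_def field_simps)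
      finally have *: "norm (h - D (x s, s) (h, t - s)) \<le> e' * norm (h, t - s)"
        using d(2)[of "(x t, t)"] x(2)[OF s] x(2)[OF t] by (simp add: h_def)
      \<comment> \<open>Replacing \<open>v s\<close> by \<open>D (x s, s) (v s, 1)\<close> leaves an
        increment in the first component alone, where the derivative has norm at most 1/2.\<close>
      have "D (x s, s) (h, t - s) - (t - s) *\<^sub>R v s = D (x s, s) ((h, t - s) - (t - s) *\<^sub>R (v s, 1))"
        using v[OF s] by (simp only: blinfun.diff_right blinfun.scaleR_right)
      also have "\<dots> = D (x s, s) (h - (t - s) *\<^sub>R v s, 0)" by simp
      finally have "norm (D (x s, s) (h, t - s) - (t - s) *\<^sub>R v s) \<le> 1/2 * norm (h - (t - s) *\<^sub>R v s)"
        using half[OF near[OF x(1)[OF s] s]] by metis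
      moreover have "norm (h - (t - s) *\<^sub>R v s) \<le> norm (h - D (x s, s) (h, t - s))
          + norm (D (x s, s) (h, t - s) - (t - s) *\<^sub>R v s)"
        using norm_triangle_ineq[of "h - D (x s, s) (h, t - s)" "D (x s, s) (h, t - s) - (t - s) *\<^sub>R v s"] by simp
      ultimately have "norm (h - (t - s) *\<^sub>R v s) \<le> 2 * (e' * norm (h, t - s))"
        using * by linarith
      also have "\<dots> \<le> 2 * (e' * ((2 * M + 1) * \<bar>t - s\<bar>))"
        using n e' by (intro mult_left_mono) auto
      also have "\<dots> = e * norm (t - s)" using M1 by (simp add: e'_def field_simps)
      finally show ?thesis by (simp add: h_def)
    qed
    ultimately show "\<exists>d>0. \<forall>y. norm (y - s) < d \<longrightarrow> norm (x y - x s - (y - s) *\<^sub>R v s) \<le> e * norm (y - s)"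
      by blast
  qed
  moreover have "continuous_on {-\<delta><..<\<delta>} v"
    unfolding continuous_on_def
  proof (intro ballI)
    fix s assume "s \<in> {-\<delta><..<\<delta>}"
    then have s: "\<bar>s\<bar> < \<delta>" by auto
    have contx: "continuous_on {-\<delta><..<\<delta>} x"
      by (intro continuous_on_subset[OF lipschitz_on_continuous_on[OF lipschitz_onI[of _ x "2 * M"]] subset_refl])
        (use lip M1 in \<open>auto simp: dist_norm\<close>)
    have "continuous_on {-\<delta><..<\<delta>} (\<lambda>t. D (x t, t))"
      by (intro continuous_on_compose2[OF contD] continuous_intros contx) auto
    then have "((\<lambda>t. D (x t, t) - D (x s, s)) \<longlongrightarrow> 0) (at s within {-\<delta><..<\<delta>})"
      using \<open>s \<in> _\<close> unfolding continuous_on_def by (subst LIM_zero_iff) auto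
    then have "((\<lambda>t. 2 * (norm (D (x t, t) - D (x s, s)) * norm (v s, 1::real))) \<longlongrightarrow> 0) (at s within {-\<delta><..<\<delta>})"
      by (intro tendsto_mult_right_zero tendsto_mult_left_zero tendsto_norm_zero)
    then have "((\<lambda>t. v t - v s) \<longlongrightarrow> 0) (at s within {-\<delta><..<\<delta>})"
    proof (rule Lim_null_comparison[rotated])
      show "\<forall>\<^sub>F t in at s within {-\<delta><..<\<delta>}. norm (v t - v s) \<le> 2 * (norm (D (x t, t) - D (x s, s)) * norm (v s, 1::real))"
      proof (rule eventually_at_topological[THEN iffD2], intro exI[of _ UNIV] conjI ballI impI open_UNIV UNIV_I)
        fix t assume "t \<in> {-\<delta><..<\<delta>}"
        then have t: "\<bar>t\<bar> < \<delta>" by auto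
        \<comment> \<open>The first term is at most half of the left side and is absorbed; the
          second applies a small difference of operators to the fixed vector
          \<open>(v s, 1)\<close>.\<close>
        have "v t - v s = D (x t, t) ((v t, 1) - (v s, 1)) + (D (x t, t) - D (x s, s)) (v s, 1)"
          using v[OF s] v[OF t] by (simp only: blinfun.diff_right blinfun.diff_left) simp
        then have "norm (v t - v s) \<le> norm (D (x t, t) (v t - v s, 0)) + norm ((D (x t, t) - D (x s, s)) (v s, 1))"
          using norm_triangle_ineq[of "D (x t, t) (v t - v s, 0)" "(D (x t, t) - D (x s, s)) (v s, 1)"] by simp
        moreover have "norm (D (x t, t) (v t - v s, 0)) \<le> 1/2 * norm (v t - v s)"
          by (intro half near x t)
        moreover have "norm ((D (x t, t) - D (x s, s)) (v s, 1)) \<le> norm (D (x t, t) - D (x s, s)) * norm (v s, 1::real)"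
          by (rule norm_blinfun)
        ultimately show "norm (v t - v s) \<le> 2 * (norm (D (x t, t) - D (x s, s)) * norm (v s, 1::real))"
          by linarith
      qed
    qed
    then show "(v \<longlongrightarrow> v s) (at s within {-\<delta><..<\<delta>})" by (subst (asm) LIM_zero_iff)
  qed
  ultimately have C1: "x C1_differentiable_on {-\<delta><..<\<delta>}"
    unfolding C1_differentiable_on_def by (intro exI[of _ v]) auto
  show ?thesis
    by (rule that[where \<delta>=\<delta> and x=x, OF \<delta>(1) x0 _ C1]) (simp only: x(2))
qed

section \<open>Integral operators on bounded continuous functions\<close>

definition primitive :: "(real \<Rightarrow> real) \<Rightarrow> real \<Rightarrow> real" where
  "primitive g x = (LBINT t=0..x. g t)"

lemma primitive_0 [simp]: "primitive g 0 = 0"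
  by (simp add: primitive_def zero_ereal_def)

lemma primitive_deriv:
  assumes g: "continuous_on UNIV g"
  shows "(primitive g has_real_derivative g x) (at x)"
proof -
  \<comment> \<open>The interval has to contain 0 as well as a neighborhood of \<open>x\<close>, so
    that the derivative within it is the full derivative at \<open>x\<close>.\<close>
  let ?b = "\<bar>x\<bar> + 1"
  have "((\<lambda>u. LBINT y=(0::real)..u. g y) has_vector_derivative g x) (at x within {-?b..?b})"
    by (rule interval_integral_FTC2) (auto intro: continuous_on_subset[OF g])
  moreover have "at x within {-?b..?b} = at x"
    by (rule at_within_Icc_at) auto
  moreover have "(\<lambda>u. LBINT y=(0::real)..u. g y) = primitive g"
    by (simp add: primitive_def zero_ereal_def fun_eq_iff)
  ultimately show ?thesis
    by (simp add: has_real_derivative_iff_has_vector_derivative)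
qed

lemma continuous_on_primitive:
  "continuous_on UNIV g \<Longrightarrow> continuous_on A (primitive g)"
  by (rule DERIV_continuous_on[OF has_field_derivative_at_within[OF primitive_deriv]])

text \<open>Identities between primitives are proved through this lemma: differentiate the candidate
  and check its value at 0.\<close>

lemma primitive_unique:
  assumes g: "continuous_on UNIV g" and F: "\<And>x. (F has_real_derivative g x) (at x)" and 0: "F 0 = 0"
  shows "primitive g x = F x"
proof -
  have "((\<lambda>x. primitive g x - F x) has_real_derivative 0) (at x)" for x
    using DERIV_diff[OF primitive_deriv[OF g] F, of x] by simp
  then have "primitive g x - F x = primitive g 0 - F 0"
    by (intro DERIV_isconst_all) auto
  then show ?thesis by (simp add: 0)
qed

lemma primitive_comb:
  assumes "continuous_on UNIV f" "continuous_on UNIV g"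
  shows "primitive (\<lambda>x. a * f x + b * g x) x = a * primitive f x + b * primitive g x"
  by (rule primitive_unique)
    (auto intro!: continuous_intros assms derivative_eq_intros primitive_deriv)

text \<open>Agreement strictly inside the interval suffices, which allows comparing functions that
  are only meaningful on \<open>[0, \<pi>]\<close>.\<close>

lemma primitive_cong:
  assumes "0 \<le> x" "\<And>t. 0 < t \<Longrightarrow> t < x \<Longrightarrow> f t = g t"
  shows "primitive f x = primitive g x"
  unfolding primitive_def using assms
  by (intro interval_integral_cong) (auto simp: einterval_def)

lemma primitive_bound:
  assumes "0 \<le> x" "continuous_on UNIV g" "\<And>t. \<bar>g t\<bar> \<le> c"
  shows "\<bar>primitive g x\<bar> \<le> c * x"
proof -
  have "norm (primitive g x - primitive g 0) \<le> c * norm (x - 0)"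
  proof (rule field_differentiable_bound[of UNIV])
    show "(primitive g has_field_derivative g z) (at z within UNIV)" for z
      using primitive_deriv[OF assms(2)] by simp
  qed (use assms in auto)
  then show ?thesis using assms(1) by simp
qed

section \<open>Bounded linear and bilinear maps on bounded continuous functions\<close>

definition bcf_mult :: "(real \<Rightarrow>\<^sub>C real) \<Rightarrow> (real \<Rightarrow>\<^sub>C real) \<Rightarrow> (real \<Rightarrow>\<^sub>C real)" where
  "bcf_mult f g = Bcontfun (\<lambda>x. f x * g x)"

lemma bcf_mult_apply [simp]: "bcf_mult f g x = f x * g x"
proof -
  have "(\<lambda>x. f x * g x) \<in> bcontfun"
  proof (rule bcontfun_normI[where b="norm f * norm g"])
    show "norm (f x * g x) \<le> norm f * norm g" for x
      using mult_mono[OF norm_bounded[of f x] norm_bounded[of g x]] by (simp add: abs_mult)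
  qed (intro continuous_on_mult continuous_on_apply_bcontfun)
  then show ?thesis by (simp add: bcf_mult_def Bcontfun_inverse)
qed

lemma bounded_bilinear_bcf_mult: "bounded_bilinear bcf_mult"
proof
  show "\<exists>K. \<forall>a b. norm (bcf_mult a b) \<le> norm a * norm b * K"
  proof (intro exI[of _ 1] allI norm_bound)
    show "norm (bcf_mult a b x) \<le> norm a * norm b * 1" for a b x
      using mult_mono[OF norm_bounded[of a x] norm_bounded[of b x]] by (simp add: abs_mult)
  qed
qed (auto intro!: bcontfun_eqI simp: algebra_simps)

text \<open>Functions on \<open>[0, \<pi>]\<close> are represented by bounded continuous functions on the line,
  whose values outside \<open>[0, \<pi>]\<close> are irrelevant.\<close>

definition bcf_primitive :: "(real \<Rightarrow>\<^sub>C real) \<Rightarrow> (real \<Rightarrow>\<^sub>C real)" where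
  "bcf_primitive f = Bcontfun (\<lambda>x. primitive f (max 0 (min pi x)))"

text \<open>Clamping the argument to \<open>[0, \<pi>]\<close> keeps the primitive bounded without
  destroying continuity.\<close>

lemma bcf_primitive_apply': "bcf_primitive f x = primitive f (max 0 (min pi x))"
  and bcf_primitive_bound: "\<bar>bcf_primitive f x\<bar> \<le> norm f * pi"
proof -
  have b: "\<bar>primitive f (max 0 (min pi x))\<bar> \<le> norm f * pi" for x
  proof -
    have "\<bar>primitive f (max 0 (min pi x))\<bar> \<le> norm f * max 0 (min pi x)"
      by (rule primitive_bound) (simp_all add: norm_bounded[where 'b=real, simplified])
    also have "\<dots> \<le> norm f * pi" by (intro mult_left_mono) auto
    finally show ?thesis .
  qed
  have "continuous_on UNIV (\<lambda>x. primitive f (max 0 (min pi x)))"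
    by (rule continuous_on_compose2[OF continuous_on_primitive[of f UNIV]])
      (auto intro!: continuous_on_max continuous_on_min continuous_on_const continuous_on_id)
  then have "(\<lambda>x. primitive f (max 0 (min pi x))) \<in> bcontfun"
    by (rule bcontfun_normI[where b="norm f * pi"]) (simp add: b)
  then show "bcf_primitive f x = primitive f (max 0 (min pi x))"
    by (simp add: bcf_primitive_def Bcontfun_inverse)
  then show "\<bar>bcf_primitive f x\<bar> \<le> norm f * pi" using b by simp
qed

lemma bcf_primitive_apply: "0 \<le> x \<Longrightarrow> x \<le> pi \<Longrightarrow> bcf_primitive f x = primitive f x"
  by (simp add: bcf_primitive_apply' max_absorb2 min_absorb2)

lemma bounded_linear_bcf_primitive: "bounded_linear bcf_primitive"
proof
  fix f g :: "real \<Rightarrow>\<^sub>C real" and r :: real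
  have "primitive (f + g) x = primitive f x + primitive g x" for x
    using primitive_comb[of f g 1 1 x] by (simp add: plus_bcontfun.rep_eq)
  then show "bcf_primitive (f + g) = bcf_primitive f + bcf_primitive g"
    by (intro bcontfun_eqI) (simp add: bcf_primitive_apply')
  have "primitive (r *\<^sub>R f) x = r * primitive f x" for x
    using primitive_comb[of f f r 0 x] by (simp add: scaleR_bcontfun.rep_eq)
  then show "bcf_primitive (r *\<^sub>R f) = r *\<^sub>R bcf_primitive f"
    by (intro bcontfun_eqI) (simp add: bcf_primitive_apply')
  show "\<exists>K. \<forall>f. norm (bcf_primitive f) \<le> norm f * K"
    by (intro exI[of _ pi] allI norm_bound) (simp add: bcf_primitive_bound)
qed

lemma bcf_primitive_deriv:
  assumes "x \<in> {0..pi}"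
  shows "(bcf_primitive f has_real_derivative f x) (at x within {0..pi})"
proof -
  have "(primitive f has_real_derivative f x) (at x within {0..pi})"
    by (rule has_field_derivative_at_within[OF primitive_deriv[OF continuous_on_apply_bcontfun]])
  from has_field_derivative_transform_within[OF this zero_less_one assms, of "bcf_primitive f"]
  show ?thesis by (simp add: bcf_primitive_apply)
qed

definition bcf_integral :: "(real \<Rightarrow>\<^sub>C real) \<Rightarrow> real" where
  "bcf_integral f = bcf_primitive f pi"

lemma bcf_integral: "bcf_integral f = primitive f pi"
  by (simp add: bcf_integral_def bcf_primitive_apply)

lemma bounded_linear_bcf_integral: "bounded_linear bcf_integral"
proof -
  have "bounded_linear (\<lambda>f::real \<Rightarrow>\<^sub>C real. f pi)"
    by standard (use norm_bounded[where 'b=real] in \<open>auto intro!: exI[of _ 1]\<close>)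
  from bounded_linear_compose[OF this bounded_linear_bcf_primitive]
  show ?thesis by (simp add: bcf_integral_def[abs_def])
qed

definition bcf_sin :: "real \<Rightarrow> (real \<Rightarrow>\<^sub>C real)" where "bcf_sin k = Bcontfun (\<lambda>x. sin (k * x))"
definition bcf_cos :: "real \<Rightarrow> (real \<Rightarrow>\<^sub>C real)" where "bcf_cos k = Bcontfun (\<lambda>x. cos (k * x))"

lemma bcf_sin_apply [simp]: "bcf_sin k x = sin (k * x)"
  and bcf_cos_apply [simp]: "bcf_cos k x = cos (k * x)"
proof -
  have "(\<lambda>x. sin (k * x)) \<in> bcontfun" "(\<lambda>x. cos (k * x)) \<in> bcontfun"
    by (rule bcontfun_normI[where b=1]; auto intro!: continuous_intros)+
  then show "bcf_sin k x = sin (k * x)" "bcf_cos k x = cos (k * x)"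
    by (simp_all add: bcf_sin_def bcf_cos_def Bcontfun_inverse)
qed

text \<open>Variation of constants: \<open>oscillator 0 k g\<close> solves \<open>u''' + k\<^sup>2 u' = g\<close> with
  \<open>u(0) = u'(0) = u''(0) = 0\<close>, and \<open>oscillator j k g\<close> is its \<open>j\<close>-th derivative.\<close>

definition oscillator :: "nat \<Rightarrow> real \<Rightarrow> (real \<Rightarrow> real) \<Rightarrow> real \<Rightarrow> real" where
  "oscillator j k g x =
     (let c = primitive (\<lambda>t. g t * cos (k * t)) x; s = primitive (\<lambda>t. g t * sin (k * t)) x in
      if j = 0 then (primitive g x - cos (k * x) * c - sin (k * x) * s) / k\<^sup>2
      else if j = 1 then (sin (k * x) * c - cos (k * x) * s) / k
      else if j = 2 then cos (k * x) * c + sin (k * x) * s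
      else g x - k * (sin (k * x) * c - cos (k * x) * s))"

lemma oscillator_0 [simp]: "j < 3 \<Longrightarrow> oscillator j k g 0 = 0"
  by (simp add: oscillator_def)

lemma oscillator_ode:
  "k \<noteq> 0 \<Longrightarrow> oscillator 3 k g x = g x - k\<^sup>2 * oscillator 1 k g x"
  by (simp add: oscillator_def Let_def power2_eq_square)

text \<open>The terms that arise from differentiating the two primitives cancel for
  \<open>j = 1\<close>; for \<open>j = 0\<close> and \<open>j = 2\<close> they combine to
  \<open>g\<close> by \<open>cos\<^sup>2 + sin\<^sup>2 = 1\<close>.\<close>

lemma oscillator_deriv:
  assumes g: "continuous_on UNIV g" and k: "k \<noteq> 0" and j: "j < 3"
  shows "(oscillator j k g has_real_derivative oscillator (Suc j) k g x) (at x)"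
proof -
  define C where "C = primitive (\<lambda>t. g t * cos (k * t))"
  define S where "S = primitive (\<lambda>t. g t * sin (k * t))"
  have P: "(C has_real_derivative g x * cos (k * x)) (at x)"
    "(S has_real_derivative g x * sin (k * x)) (at x)"
    unfolding C_def S_def by (intro primitive_deriv continuous_intros g)+
  have q: "cos (k * x) * (g x * cos (k * x)) + sin (k * x) * (g x * sin (k * x)) = g x"
  proof -
    have "cos (k * x) * (g x * cos (k * x)) + sin (k * x) * (g x * sin (k * x))
      = g x * (cos (k * x) * cos (k * x) + sin (k * x) * sin (k * x))" by algebra
    then show ?thesis by (simp only: sin_cos_squared_add3 mult_1_right)
  qed
  note osc = oscillator_def[abs_def] Let_def C_def[symmetric] S_def[symmetric]
  consider "j = 0" | "j = 1" | "j = 2" using j by linarith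
  then show ?thesis
  proof cases
    case 1
    have "((\<lambda>x. primitive g x - cos (k * x) * C x - sin (k * x) * S x) has_real_derivative
        (g x - (cos (k * x) * (g x * cos (k * x)) - sin (k * x) * k * C x)
          - (cos (k * x) * k * S x + sin (k * x) * (g x * sin (k * x))))) (at x)"
      by (auto intro!: derivative_eq_intros P primitive_deriv[OF g] simp: algebra_simps)
    from DERIV_cdivide[OF this, of "k\<^sup>2"]
    have "((\<lambda>x. (primitive g x - cos (k * x) * C x - sin (k * x) * S x) / k\<^sup>2) has_real_derivative
        (g x - (cos (k * x) * (g x * cos (k * x)) - sin (k * x) * k * C x)
          - (cos (k * x) * k * S x + sin (k * x) * (g x * sin (k * x)))) / k\<^sup>2) (at x)" .
    moreover have "g x - (cos (k * x) * (g x * cos (k * x)) - sin (k * x) * k * C x)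
          - (cos (k * x) * k * S x + sin (k * x) * (g x * sin (k * x)))
        = k * (sin (k * x) * C x - cos (k * x) * S x)"
      using q by (simp add: algebra_simps)
    ultimately show ?thesis using k by (simp add: 1 osc power2_eq_square)
  next
    case 2
    have "((\<lambda>x. (sin (k * x) * C x - cos (k * x) * S x) / k) has_real_derivative
        cos (k * x) * C x + sin (k * x) * S x) (at x)"
      using k by (auto intro!: derivative_eq_intros P simp: field_simps)
    then show ?thesis by (simp add: 2 osc)
  next
    case 3
    have "((\<lambda>x. cos (k * x) * C x + sin (k * x) * S x) has_real_derivative
        g x - k * (sin (k * x) * C x - cos (k * x) * S x)) (at x)"
      using q by (auto intro!: derivative_eq_intros P simp: algebra_simps)
    then show ?thesis by (simp add: 3 osc)
  qed
qed

lemma continuous_on_oscillator: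
  assumes g: "continuous_on UNIV g" and k: "k \<noteq> 0" and j: "j \<le> 3"
  shows "continuous_on A (oscillator j k g)"
proof -
  have *: "continuous_on A (oscillator j k g)" if "j < 3" for j
    by (rule DERIV_continuous_on[OF has_field_derivative_at_within[OF oscillator_deriv[OF g k that]]])
  show ?thesis
  proof (cases "j < 3")
    case False
    then have "j = 3" using j by simp
    moreover have "continuous_on A (\<lambda>x. g x - k\<^sup>2 * oscillator 1 k g x)"
      by (rule continuous_on_diff[OF continuous_on_subset[OF g] continuous_on_mult[OF continuous_on_const *]]) auto
    ultimately show ?thesis by (simp add: oscillator_ode[OF k, abs_def])
  qed (rule *)
qed

lemma primitive_oscillator:
  assumes "continuous_on UNIV g" "k \<noteq> 0"
  shows "primitive (oscillator 1 k g) x = oscillator 0 k g x"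
  using assms oscillator_deriv[OF assms, of 0]
  by (intro primitive_unique continuous_on_oscillator) auto

text \<open>This is \<open>oscillator 1 k\<close> on \<open>[0, \<pi>]\<close>, assembled from
  bounded linear maps so that its continuity in the sup norm comes for free.\<close>

definition bcf_oscillator :: "real \<Rightarrow> (real \<Rightarrow>\<^sub>C real) \<Rightarrow> (real \<Rightarrow>\<^sub>C real)" where
  "bcf_oscillator k f = (1 / k) *\<^sub>R (bcf_mult (bcf_sin k) (bcf_primitive (bcf_mult f (bcf_cos k)))
      - bcf_mult (bcf_cos k) (bcf_primitive (bcf_mult f (bcf_sin k))))"

lemma bounded_linear_bcf_oscillator: "bounded_linear (bcf_oscillator k)"
proof -
  note mult = bounded_bilinear.bounded_linear_right[OF bounded_bilinear_bcf_mult]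
    bounded_bilinear.bounded_linear_left[OF bounded_bilinear_bcf_mult]
  have "bounded_linear (\<lambda>f. bcf_mult u (bcf_primitive (bcf_mult f v)))" for u v
    using bounded_linear_compose[OF mult(1) bounded_linear_compose[OF bounded_linear_bcf_primitive mult(2)], of u v] .
  then show ?thesis
    unfolding bcf_oscillator_def[abs_def]
    by (intro bounded_linear_const_scaleR bounded_linear_sub)
qed

lemma bcf_oscillator_apply:
  assumes "0 \<le> x" "x \<le> pi"
  shows "bcf_oscillator k f x = oscillator 1 k f x"
proof -
  have "bcf_primitive (bcf_mult f (bcf_cos k)) x = primitive (\<lambda>t. f t * cos (k * t)) x"
    "bcf_primitive (bcf_mult f (bcf_sin k)) x = primitive (\<lambda>t. f t * sin (k * t)) x"
    using assms by (auto simp: bcf_primitive_apply intro!: arg_cong2[where f=primitive])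
  then show ?thesis by (simp add: bcf_oscillator_def oscillator_def)
qed

section \<open>The blown-up problem\<close>

text \<open>Joins the normed space and the complete space structure, as the contraction argument
  demands of the unknowns.\<close>

instance bcontfun :: (metric_space, banach) banach ..

type_synonym bcf = "real \<Rightarrow>\<^sub>C real"

text \<open>The first term is the derivative of \<open>sin (k x)\<close>, a solution of the
  homogeneous equation. The oscillator term vanishes at 0, so the slope of the profile at 0 is
  \<open>k\<close> for every \<open>f\<close>.\<close>

definition bcf_slope :: "real \<Rightarrow> real \<Rightarrow> bcf \<Rightarrow> bcf" where
  "bcf_slope k w f = k *\<^sub>R bcf_cos k + w *\<^sub>R bcf_oscillator k f"

text \<open>This is \<open>(\<beta> cos \<theta> - 1) / w\<^sup>2\<close> with the division carried
  out: expand \<open>(1 + w\<^sup>2 b) (1 - w\<^sup>2 d) - 1\<close>.\<close>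

definition bcf_height :: "real \<Rightarrow> bcf \<Rightarrow> real \<Rightarrow> bcf" where
  "bcf_height w d b = b *\<^sub>R const_bcontfun 1 - d - (w\<^sup>2 * b) *\<^sub>R d"

text \<open>The unknowns of the blown-up problem: \<open>\<theta> = w \<phi>\<close> with \<open>\<phi>' = bcf_slope k w f\<close>,
  \<open>cos \<theta> = 1 - w\<^sup>2 d\<close>, \<open>\<beta> = 1 + w\<^sup>2 b\<close>, \<open>(\<alpha> - 1) \<beta>\<^sup>2 / 4 = k\<^sup>2 + w m\<close> and
  \<open>\<phi>''' + k\<^sup>2 \<phi>' = w f\<close>. The equations for \<open>b\<close> and \<open>m\<close> are the solvability conditions
  \<open>\<integral> f = 0\<close> and \<open>\<integral> f cos k = 0\<close>.\<close>

definition reduced_solution ::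
  "real \<Rightarrow> real \<Rightarrow> bcf \<Rightarrow> real \<Rightarrow> real \<Rightarrow> bcf \<Rightarrow> bool" where
  "reduced_solution k w d b m f \<longleftrightarrow>
     d = bcf_primitive (bcf_mult (bcf_primitive (bcf_slope k w f - w\<^sup>2 *\<^sub>R bcf_mult d (bcf_slope k w f)))
           (bcf_slope k w f)) \<and>
     b = (bcf_integral d + w\<^sup>2 * b * bcf_integral d) / pi \<and>
     m = 2 / (k * pi) * ((1 + w\<^sup>2 * b) ^ 3 / 4 * bcf_integral (bcf_mult (bcf_height w d b) (bcf_cos k))
           - w * m * bcf_integral (bcf_mult (bcf_oscillator k f) (bcf_cos k))) \<and>
     f = ((1 + w\<^sup>2 * b) ^ 3 / 4) *\<^sub>R bcf_height w d b - m *\<^sub>R bcf_slope k w f"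

text \<open>At \<open>w = 0\<close> the reduced equations are triangular but not constant:
  \<open>b\<close> depends on \<open>d\<close>, and \<open>m\<close> and \<open>f\<close> on what
  precedes them. Feeding each updated component \<open>d'\<close>, \<open>b'\<close>,
  \<open>m'\<close> into the later ones makes the map constant at \<open>w = 0\<close>, as
  \<open>C1_fixed_point_curve\<close> requires, and its fixed points still solve the reduced
  equations.\<close>

lemma reduced_solution_curve:
  obtains \<delta> d b m f where "\<delta> > 0"
    "(\<lambda>w. (d w, b w, m w, f w)) C1_differentiable_on {-\<delta><..<\<delta>}"
    "\<And>w. \<bar>w\<bar> < \<delta> \<Longrightarrow> reduced_solution k w (d w) (b w) (m w) (f w)"
proof -
  let ?V = bcf_primitive and ?M = bcf_mult and ?I = bcf_integral and ?c = "bcf_cos k"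
  define W :: "(bcf \<times> real \<times> real \<times> bcf) \<times> real \<Rightarrow> real" where "W = (\<lambda>z. snd z)"
  define d :: "(bcf \<times> real \<times> real \<times> bcf) \<times> real \<Rightarrow> bcf" where "d = (\<lambda>z. fst (fst z))"
  define b :: "(bcf \<times> real \<times> real \<times> bcf) \<times> real \<Rightarrow> real" where "b = (\<lambda>z. fst (snd (fst z)))"
  define m :: "(bcf \<times> real \<times> real \<times> bcf) \<times> real \<Rightarrow> real" where "m = (\<lambda>z. fst (snd (snd (fst z))))"
  define f :: "(bcf \<times> real \<times> real \<times> bcf) \<times> real \<Rightarrow> bcf" where "f = (\<lambda>z. snd (snd (snd (fst z))))"
  define P where "P = (\<lambda>z. k *\<^sub>R bcf_cos k + W z *\<^sub>R bcf_oscillator k (f z))"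
  define S where "S = (\<lambda>z. ?V (P z - (W z)\<^sup>2 *\<^sub>R ?M (d z) (P z)))"
  define d' where "d' = (\<lambda>z. ?V (?M (S z) (P z)))"
  define b' where "b' = (\<lambda>z. (1 / pi) * (?I (d' z) + (W z)\<^sup>2 * b z * ?I (d' z)))"
  define h where "h = (\<lambda>z. b' z *\<^sub>R const_bcontfun 1 - d' z - ((W z)\<^sup>2 * b' z) *\<^sub>R d' z)"
  define B where "B = (\<lambda>z. (1/4) * (1 + (W z)\<^sup>2 * b' z) ^ 3)"
  define m' where "m' = (\<lambda>z. 2 / (k * pi) * (B z * ?I (?M (h z) ?c)
      - W z * m z * ?I (?M (bcf_oscillator k (f z)) ?c)))"
  define f' where "f' = (\<lambda>z. B z *\<^sub>R h z - m' z *\<^sub>R P z)"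
  note lin = C1_map_bounded_linear[OF bounded_linear_bcf_primitive]
    C1_map_bounded_linear[OF bounded_linear_bcf_integral]
    C1_map_bounded_linear[OF bounded_linear_bcf_oscillator]
    C1_map_bilinear[OF bounded_bilinear_bcf_mult]
  have C: "C1_map W" "C1_map d" "C1_map b" "C1_map m" "C1_map f"
    unfolding W_def d_def b_def m_def f_def
    by (intro C1_map_fst C1_map_snd C1_map_ident)+
  have P: "C1_map P" unfolding P_def by (intro C1_map_intros lin C)
  have S: "C1_map S" unfolding S_def by (intro C1_map_intros lin C P)
  have d': "C1_map d'" unfolding d'_def by (intro C1_map_intros lin C P S)
  have b': "C1_map b'" unfolding b'_def by (intro C1_map_intros lin C d')
  have h: "C1_map h" unfolding h_def by (intro C1_map_intros lin C d' b')
  have B: "C1_map B" unfolding B_def by (intro C1_map_intros lin C b')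
  have m': "C1_map m'" unfolding m'_def by (intro C1_map_intros lin C B h)
  have f': "C1_map f'" unfolding f'_def by (intro C1_map_intros lin C B h m' P)
  define \<Phi> where "\<Phi> = (\<lambda>z. (d' z, b' z, m' z, f' z))"
  have \<Phi>: "C1_map \<Phi>" unfolding \<Phi>_def by (intro C1_map_Pair d' b' m' f')
  \<comment> \<open>At \<open>w = 0\<close> the dependence on the unknowns disappears in the order
    in which the components are computed.\<close>
  have P0: "P (x, 0) = k *\<^sub>R bcf_cos k" for x by (simp add: P_def W_def)
  have d0: "d' (x, 0) = d' (0, 0)" for x by (simp add: d'_def S_def P0 W_def)
  have b0: "b' (x, 0) = b' (0, 0)" for x by (simp add: b'_def d0[of x] W_def)
  have h0: "h (x, 0) = h (0, 0)" for x by (simp add: h_def d0[of x] b0[of x] W_def)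
  have m0: "m' (x, 0) = m' (0, 0)" for x by (simp add: m'_def B_def h0[of x] W_def)
  have f0: "f' (x, 0) = f' (0, 0)" for x by (simp add: f'_def B_def h0[of x] m0[of x] P0 W_def)
  have "\<Phi> (x, 0) = \<Phi> (0, 0)" for x
    unfolding \<Phi>_def d0[of x] b0[of x] m0[of x] f0[of x] ..
  from C1_fixed_point_curve[OF \<Phi> this] obtain \<delta> x where \<delta>: "\<delta> > 0"
    and x: "\<And>t. \<bar>t\<bar> < \<delta> \<Longrightarrow> x t = \<Phi> (x t, t)" and C1: "x C1_differentiable_on {-\<delta><..<\<delta>}"
    by metis
  show ?thesis
  proof (rule that[OF \<delta>, where d="\<lambda>w. d (x w, w)" and b="\<lambda>w. b (x w, w)" and m="\<lambda>w. m (x w, w)"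
      and f="\<lambda>w. f (x w, w)"])
    show "(\<lambda>w. (d (x w, w), b (x w, w), m (x w, w), f (x w, w))) C1_differentiable_on {-\<delta><..<\<delta>}"
      using C1 by (simp add: d_def b_def m_def f_def)
    fix w assume "\<bar>w\<bar> < \<delta>"
    define z where "z = (x w, w)"
    have e: "fst z = (d' z, b' z, m' z, f' z)"
      using x[OF \<open>\<bar>w\<bar> < \<delta>\<close>] by (simp add: z_def \<Phi>_def)
    \<comment> \<open>At the fixed point the updated components equal the unknowns, which undoes the
      substitution.\<close>
    have z: "d z = d' z" "b z = b' z" "m z = m' z" "f z = f' z"
      unfolding d_def b_def m_def f_def by (subst e, simp)+
    have [simp]: "W z = w" by (simp add: W_def z_def)
    have p: "P z = bcf_slope k w (f z)" by (simp add: P_def bcf_slope_def)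
    have hz: "h z = bcf_height w (d z) (b z)" by (simp add: h_def bcf_height_def z(1,2)[symmetric])
    show "reduced_solution k w (d z) (b z) (m z) (f z)"
      unfolding reduced_solution_def
    proof (intro conjI)
      show "d z = ?V (?M (?V (bcf_slope k w (f z) - w\<^sup>2 *\<^sub>R ?M (d z) (bcf_slope k w (f z)))) (bcf_slope k w (f z)))"
        using z(1) by (simp add: d'_def S_def p)
      show "b z = (?I (d z) + w\<^sup>2 * b z * ?I (d z)) / pi"
        using z(2) unfolding b'_def z(1)[symmetric] by simp
      have Bz: "B z = (1 + w\<^sup>2 * b z) ^ 3 / 4" by (simp add: B_def z(2)[symmetric])
      show "m z = 2 / (k * pi) * ((1 + w\<^sup>2 * b z) ^ 3 / 4 * ?I (?M (bcf_height w (d z) (b z)) ?c)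
           - w * m z * ?I (?M (bcf_oscillator k (f z)) ?c))"
        using z(3) unfolding m'_def Bz hz by simp
      show "f z = ((1 + w\<^sup>2 * b z) ^ 3 / 4) *\<^sub>R bcf_height w (d z) (b z) - m z *\<^sub>R bcf_slope k w (f z)"
        using z(4) unfolding f'_def Bz hz z(3)[symmetric] p .
    qed
  qed
qed

section \<open>Classical functions in the odd Sobolev space\<close>

lemma set_integral_FTC_period:
  assumes F: "\<And>x. (F has_real_derivative f x) (at x)" and f: "continuous_on UNIV f"
  shows "(LINT x:{0..2*pi}|lborel. f x) = F (2*pi) - F 0"
proof -
  have "(\<integral>x. f x * indicator {0..2*pi} x \<partial>lborel) = F (2*pi) - F 0"
    using f by (intro integral_FTC_Icc_real F) (auto simp: continuous_on_eq_continuous_at)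
  then show ?thesis by (simp add: set_lebesgue_integral_def mult.commute)
qed

lemma periodic_fun_simple_0_2pi: "periodic_fun_simple f (2*pi) \<Longrightarrow> f (2*pi) = f 0"
  unfolding periodic_fun_simple_def by (metis add_0)

lemma periodic_derivative:
  assumes D: "\<And>x. (f has_real_derivative f' x) (at x)" and per: "periodic_fun_simple f p"
  shows "periodic_fun_simple f' p"
proof -
  have "deriv f = f'" using D by (intro ext DERIV_imp_deriv)
  then show ?thesis using deriv_periodic[OF per, of 1] by simp
qed

text \<open>Integration by parts over one period; the boundary terms cancel by periodicity.\<close>

lemma has_weak_deriv_Suc:
  assumes u: "\<And>x. (u has_real_derivative u' x) (at x)" and cont: "continuous_on UNIV u'"
    and per: "periodic_fun_simple u (2*pi)" and v: "has_weak_deriv n u' v"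
  shows "has_weak_deriv (Suc n) u v"
  unfolding has_weak_deriv_def
proof
  fix \<phi> assume \<phi>: "\<phi> \<in> smooth_periodic"
  let ?\<phi> = "\<lambda>n. (deriv ^^ n) \<phi>"
  have D: "(?\<phi> m has_real_derivative ?\<phi> (Suc m) x) (at x)" for m x
    using \<phi> by (auto simp: smooth_periodic_def DERIV_deriv_iff_real_differentiable)
  have c\<phi>: "continuous_on UNIV (?\<phi> m)" for m
    by (rule DERIV_continuous_on[OF has_field_derivative_at_within[OF D]])
  have cu: "continuous_on UNIV u"
    by (rule DERIV_continuous_on[OF has_field_derivative_at_within[OF u]])
  have pu: "periodic_fun_simple u' (2*pi)" by (rule periodic_derivative[OF u per])
  have "(LINT x:{0..2*pi}|lborel. u' x * ?\<phi> n x + u x * ?\<phi> (Suc n) x) = u (2*pi) * ?\<phi> n (2*pi) - u 0 * ?\<phi> n 0"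
  proof (rule set_integral_FTC_period)
    show "((\<lambda>x. u x * ?\<phi> n x) has_real_derivative u' x * ?\<phi> n x + u x * ?\<phi> (Suc n) x) (at x)" for x
      using DERIV_mult[OF u D[of n], of x] by (simp add: algebra_simps)
    show "continuous_on UNIV (\<lambda>x. u' x * ?\<phi> n x + u x * ?\<phi> (Suc n) x)"
      by (rule continuous_on_add[OF continuous_on_mult[OF cont c\<phi>] continuous_on_mult[OF cu c\<phi>]])
  qed
  also have "\<dots> = 0"
    using periodic_fun_simple_0_2pi[OF per] periodic_fun_simple_0_2pi[OF deriv_periodic, of \<phi> n] \<phi>
    by (simp add: smooth_periodic_def)
  also have "(LINT x:{0..2*pi}|lborel. u' x * ?\<phi> n x + u x * ?\<phi> (Suc n) x)
      = (LINT x:{0..2*pi}|lborel. u' x * ?\<phi> n x) + (LINT x:{0..2*pi}|lborel. u x * ?\<phi> (Suc n) x)"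
    by (rule set_integral_add(2)[OF weak_test_integrable[OF L2_continuous[OF cont pu] \<phi>]
          weak_test_integrable[OF L2_continuous[OF cu per] \<phi>]])
  finally have "(LINT x:{0..2*pi}|lborel. u x * ?\<phi> (Suc n) x) = - (LINT x:{0..2*pi}|lborel. u' x * ?\<phi> n x)"
    by linarith
  also have "\<dots> = (-1) ^ Suc n * (LINT x:{0..2*pi}|lborel. v x * \<phi> x)"
    using v[unfolded has_weak_deriv_def, rule_format, OF \<phi>] by simp
  finally show "(LINT x:{0..2*pi}|lborel. u x * ?\<phi> (Suc n) x) = (-1) ^ Suc n * (LINT x:{0..2*pi}|lborel. v x * \<phi> x)" .
qed

lemma sobolev_classical:
  fixes u :: "nat \<Rightarrow> real \<Rightarrow> real"
  assumes D: "\<And>j x. j < n \<Longrightarrow> (u j has_real_derivative u (Suc j) x) (at x)"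
    and cont: "\<And>j. j \<le> n \<Longrightarrow> continuous_on UNIV (u j)"
    and per: "periodic_fun_simple (u 0) (2*pi)"
  shows "u 0 \<in> sobolev_periodic n"
    and "j \<le> n \<Longrightarrow> AE x in lborel. weak_deriv j (u 0) x = u j x"
proof -
  have per': "periodic_fun_simple (u j) (2*pi)" if "j \<le> n" for j
    using that
  proof (induction j)
    case (Suc j)
    then show ?case by (intro periodic_derivative[OF D]) auto
  qed (simp add: per)
  have L: "u j \<in> L2_periodic" if "j \<le> n" for j
    using L2_continuous[OF cont per'] that by simp
  \<comment> \<open>The start \<open>i\<close> stays arbitrary in the induction because
    \<open>has_weak_deriv_Suc\<close> peels off the derivative closest to
    \<open>u i\<close>.\<close>
  have w: "has_weak_deriv j (u i) (u (i + j))" if "i + j \<le> n" for i j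
    using that
  proof (induction j arbitrary: i)
    case (Suc j)
    have "has_weak_deriv j (u (Suc i)) (u (Suc i + j))" using Suc.prems by (intro Suc.IH) simp
    then have "has_weak_deriv (Suc j) (u i) (u (Suc i + j))"
      using Suc.prems by (intro has_weak_deriv_Suc[OF D cont per']) auto
    then show ?case by simp
  qed (simp add: has_weak_deriv_0)
  show "u 0 \<in> sobolev_periodic n"
    using L w[of 0] by (auto simp: sobolev_periodic_def)
  show "AE x in lborel. weak_deriv j (u 0) x = u j x" if "j \<le> n"
    using L[of 0] L[OF that] w[of 0 j] that by (intro weak_deriv_eqI) auto
qed

text \<open>Each of the four derivatives contributes at most \<open>2 * pi * c\<^sup>2\<close> to
  the squared norm, hence the factor \<open>sqrt (8 * pi)\<close>.\<close>

lemma h3_odd_norm_bound: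
  fixes u :: "nat \<Rightarrow> real \<Rightarrow> real"
  assumes ae: "\<And>j. j \<le> 3 \<Longrightarrow> AE x in lborel. weak_deriv j (h3_fun f) x = u j x"
    and bd: "\<And>j x. j \<le> 3 \<Longrightarrow> 0 \<le> x \<Longrightarrow> x \<le> 2*pi \<Longrightarrow> \<bar>u j x\<bar> \<le> c" and c: "0 \<le> c"
  shows "norm f \<le> sqrt (8 * pi) * c"
proof -
  have "(LINT x:{0..2*pi}|lborel. weak_deriv j (h3_fun f) x * weak_deriv j (h3_fun f) x) \<le> 2*pi * c\<^sup>2" if "j \<le> 3" for j
  proof -
    have int: "set_integrable lborel {0..2*pi} (\<lambda>x. weak_deriv j (h3_fun f) x * weak_deriv j (h3_fun f) x)"
      by (intro L2_mult_integrable weak_deriv_sobolev[OF h3_fun_props(1) that])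
    have "(LINT x:{0..2*pi}|lborel. weak_deriv j (h3_fun f) x * weak_deriv j (h3_fun f) x)
        \<le> (LINT x:{0..2*pi}|lborel. c\<^sup>2)"
      unfolding set_lebesgue_integral_def
    proof (rule integral_mono_AE)
      show "integrable lborel (\<lambda>x. indicator {0..2*pi} x *\<^sub>R (weak_deriv j (h3_fun f) x * weak_deriv j (h3_fun f) x))"
        using int by (simp add: set_integrable_def)
      show "integrable lborel (\<lambda>x. indicator {0..2*pi} x *\<^sub>R c\<^sup>2)"
        by (intro integrable_scaleR_left integrable_real_indicator) auto
      show "AE x in lborel. indicator {0..2*pi} x *\<^sub>R (weak_deriv j (h3_fun f) x * weak_deriv j (h3_fun f) x)
          \<le> indicator {0..2*pi} x *\<^sub>R c\<^sup>2"
        using ae[OF that]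
      proof eventually_elim
        case (elim x)
        show ?case
        proof (cases "x \<in> {0..2*pi}")
          case True
          then have "\<bar>u j x\<bar> * \<bar>u j x\<bar> \<le> c * c" using bd[OF that, of x] c by (intro mult_mono) auto
          then show ?thesis using True elim by (simp add: power2_eq_square)
        qed simp
      qed
    qed
    also have "\<dots> = 2*pi * c\<^sup>2" by (simp add: set_lebesgue_integral_def)
    finally show ?thesis .
  qed
  then have "inner f f \<le> (\<Sum>j\<le>(3::nat). 2*pi * c\<^sup>2)"
    unfolding inner_h3_odd_def by (intro sum_mono) auto
  then have "inner f f \<le> 8 * pi * c\<^sup>2" by simp
  then have "norm f \<le> sqrt (8 * pi * c\<^sup>2)"
    unfolding norm_h3_odd_def by (rule real_sqrt_le_mono)
  then show ?thesis using c by (simp add: real_sqrt_mult)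
qed

lemma h3_oddI:
  fixes u :: "nat \<Rightarrow> real \<Rightarrow> real"
  assumes D: "\<And>j x. j < 3 \<Longrightarrow> (u j has_real_derivative u (Suc j) x) (at x)"
    and cont: "\<And>j. j \<le> 3 \<Longrightarrow> continuous_on UNIV (u j)"
    and per: "periodic_fun_simple (u 0) (2*pi)" and odd: "\<And>x. u 0 (-x) = - u 0 x"
  shows "h3_fun (Abs_h3_odd (u 0)) = u 0"
  using sobolev_classical(1)[OF D cont per] cont[of 0] odd by (intro Abs_h3_odd_inverse) simp

section \<open>Parity and periodicity of primitives and of the oscillator\<close>

text \<open>The factor \<open>c\<close> treats even functions (\<open>c = 1\<close>) and odd
  functions (\<open>c = -1\<close>) together.\<close>

lemma primitive_even_odd:
  assumes g: "continuous_on UNIV g" and c: "\<And>x. g (-x) = c * g x"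
  shows "primitive g (-x) = - c * primitive g x"
proof -
  have "primitive (\<lambda>x. c * g x + 0 * g x) x = - primitive g (-x)"
  proof (rule primitive_unique)
    show "((\<lambda>x. - primitive g (-x)) has_real_derivative c * g x + 0 * g x) (at x)" for x
      using DERIV_minus[OF DERIV_chain2[OF primitive_deriv[OF g] DERIV_minus[OF DERIV_ident]], of x] c[of x]
      by simp
  qed (auto intro!: continuous_intros g)
  then show ?thesis using primitive_comb[OF g g, of c 0 x] by simp
qed

lemma primitive_shift:
  assumes g: "continuous_on UNIV g" and per: "periodic_fun_simple g (2*pi)"
  shows "primitive g (x + 2*pi) = primitive g x + primitive g (2*pi)"
proof -
  have "((\<lambda>x. primitive g (x + 2*pi) - primitive g x) has_real_derivative 0) (at x)" for x
    using DERIV_diff[OF DERIV_shift[THEN iffD1, OF primitive_deriv[OF g, of "x + 2*pi"]] primitive_deriv[OF g, of x]] per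
    by (simp add: periodic_fun_simple_def)
  then have "primitive g (x + 2*pi) - primitive g x = primitive g (0 + 2*pi) - primitive g 0"
    by (intro DERIV_isconst_all) auto
  then show ?thesis by simp
qed

text \<open>Shifting from \<open>-pi\<close> to \<open>pi\<close> shows that the integral over a
  full period vanishes.\<close>

lemma primitive_periodic:
  assumes g: "continuous_on UNIV g" and per: "periodic_fun_simple g (2*pi)"
    and 0: "primitive g pi = primitive g (-pi)"
  shows "periodic_fun_simple (primitive g) (2*pi)"
  using primitive_shift[OF g per] primitive_shift[OF g per, of "-pi"] 0
  by (simp add: periodic_fun_simple_def)

lemma trig_periodic:
  fixes n :: nat
  shows "sin (real n * (x + 2*pi)) = sin (real n * x)" "cos (real n * (x + 2*pi)) = cos (real n * x)"
  using sin.plus_of_nat[of "real n * x" n] cos.plus_of_nat[of "real n * x" n]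
  by (simp_all add: distrib_left)

text \<open>The primitives of \<open>g\<close> and of \<open>g cos\<close> are odd, and they vanish
  at \<open>pi\<close> by the two solvability conditions. The primitive of \<open>g sin\<close> is
  even, so parity alone makes it periodic. The oscillator then inherits period and parity from these
  three.\<close>

lemma oscillator_periodic:
  fixes n :: nat
  assumes g: "continuous_on UNIV g" and per: "periodic_fun_simple g (2*pi)" and ev: "\<And>x. g (-x) = g x"
    and 0: "primitive g pi = 0" "primitive (\<lambda>x. g x * cos (real n * x)) pi = 0"
  shows "periodic_fun_simple (oscillator j (real n) g) (2*pi)"
    and "oscillator 0 (real n) g (-x) = - oscillator 0 (real n) g x"
    and "oscillator 1 (real n) g (-x) = oscillator 1 (real n) g x"
proof -
  define C where "C = primitive (\<lambda>x. g x * cos (real n * x))"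
  define S where "S = primitive (\<lambda>x. g x * sin (real n * x))"
  have c: "continuous_on UNIV (\<lambda>x. g x * cos (real n * x))" "continuous_on UNIV (\<lambda>x. g x * sin (real n * x))"
    by (intro continuous_intros g)+
  have p: "periodic_fun_simple (\<lambda>x. g x * cos (real n * x)) (2*pi)"
    "periodic_fun_simple (\<lambda>x. g x * sin (real n * x)) (2*pi)"
    using per by (simp_all add: periodic_fun_simple_def trig_periodic)
  have G: "primitive g (-x) = - primitive g x" and C: "C (-x) = - C x" and S: "S (-x) = S x" for x
    using primitive_even_odd[OF g, of 1 x] primitive_even_odd[OF c(1), of 1 x]
      primitive_even_odd[OF c(2), of "-1" x] ev by (simp_all add: C_def S_def)
  have "periodic_fun_simple (primitive g) (2*pi)"
    by (rule primitive_periodic[OF g per]) (simp add: G 0)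
  moreover have "periodic_fun_simple C (2*pi)"
    unfolding C_def by (rule primitive_periodic[OF c(1) p(1)]) (use C 0 in \<open>simp add: C_def\<close>)
  moreover have "periodic_fun_simple S (2*pi)"
    unfolding S_def by (rule primitive_periodic[OF c(2) p(2)]) (use S in \<open>simp add: S_def\<close>)
  ultimately show "periodic_fun_simple (oscillator j (real n) g) (2*pi)"
    using per by (simp add: periodic_fun_simple_def trig_periodic oscillator_def C_def[symmetric] S_def[symmetric] Let_def)
  show "oscillator 0 (real n) g (-x) = - oscillator 0 (real n) g x"
    by (simp add: oscillator_def C_def[symmetric] S_def[symmetric] G C S Let_def diff_divide_distrib add_divide_distrib)
  show "oscillator 1 (real n) g (-x) = oscillator 1 (real n) g x"
    by (simp add: oscillator_def C_def[symmetric] S_def[symmetric] C S Let_def)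
qed

text \<open>Since \<open>arccos (cos x)\<close> is the distance from \<open>x\<close> to \<open>2\<pi>\<int>\<close>, composing with it extends a
  function on \<open>[0, \<pi>]\<close> to an even periodic one. The projection makes the extension orthogonal
  to \<open>1\<close> and \<open>cos n\<close>, so that the oscillator has a periodic response.\<close>

definition even_extension :: "nat \<Rightarrow> bcf \<Rightarrow> real \<Rightarrow> real" where
  "even_extension n f x = f (arccos (cos x)) - bcf_integral f / pi
     - 2 / pi * bcf_integral (bcf_mult f (bcf_cos n)) * cos (real n * x)"

lemma continuous_on_even_extension: "continuous_on UNIV (even_extension n f)"
proof -
  have "continuous_on UNIV (\<lambda>x. arccos (cos x))"
    by (intro continuous_on_arccos continuous_intros) auto
  then have "continuous_on UNIV (\<lambda>x. f (arccos (cos x)))"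
    by (rule continuous_on_compose2[OF continuous_on_apply_bcontfun[of UNIV f]]) simp
  then show ?thesis
    unfolding even_extension_def[abs_def] by (intro continuous_intros)
qed

lemma even_extension_sym:
  "even_extension n f (-x) = even_extension n f x"
  "periodic_fun_simple (even_extension n f) (2*pi)"
  by (simp_all add: even_extension_def periodic_fun_simple_def trig_periodic)

lemma even_extension_comb:
  "even_extension n (a *\<^sub>R f + b *\<^sub>R g) x = a * even_extension n f x + b * even_extension n g x"
proof -
  interpret I: bounded_linear bcf_integral by (rule bounded_linear_bcf_integral)
  interpret M: bounded_bilinear bcf_mult by (rule bounded_bilinear_bcf_mult)
  show ?thesis
    by (simp add: even_extension_def I.add I.scaleR M.add_left M.scaleR_left algebra_simps add_divide_distrib)
qed

lemma bcf_integral_bound: "\<bar>bcf_integral f\<bar> \<le> norm f * pi"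
  by (simp add: bcf_integral_def bcf_primitive_bound)

lemma norm_bcf_mult_cos: "norm (bcf_mult f (bcf_cos k)) \<le> norm f"
proof (rule norm_bound)
  show "norm (bcf_mult f (bcf_cos k) x) \<le> norm f" for x
    using mult_mono[OF norm_bounded[of f x] abs_cos_le_one[of "k * x"]] by (simp add: abs_mult)
qed

text \<open>The constant 4 is 1 + 1 + 2, one contribution for each term of the extension.\<close>

lemma even_extension_bound: "\<bar>even_extension n f x\<bar> \<le> 4 * norm f"
proof -
  have 1: "\<bar>f (arccos (cos x))\<bar> \<le> norm f" using norm_bounded[of f] by simp
  have 2: "\<bar>bcf_integral f / pi\<bar> \<le> norm f"
    using bcf_integral_bound[of f] by (simp add: divide_simps)
  have "\<bar>bcf_integral (bcf_mult f (bcf_cos n))\<bar> \<le> norm f * pi"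
    using bcf_integral_bound[of "bcf_mult f (bcf_cos n)"] norm_bcf_mult_cos[of f n] mult_right_mono[of _ _ pi]
    by (meson order_trans pi_ge_zero)
  then have "\<bar>2 / pi * bcf_integral (bcf_mult f (bcf_cos n))\<bar> \<le> 2 * norm f"
    by (simp add: abs_mult divide_simps)
  then have "\<bar>2 / pi * bcf_integral (bcf_mult f (bcf_cos n))\<bar> * \<bar>cos (real n * x)\<bar> \<le> 2 * norm f * 1"
    by (intro mult_mono) auto
  then have 3: "\<bar>2 / pi * bcf_integral (bcf_mult f (bcf_cos n)) * cos (real n * x)\<bar> \<le> 2 * norm f"
    by (simp only: abs_mult mult_1_right)
  show ?thesis unfolding even_extension_def using 1 2 3 by linarith
qed

lemma primitive_cos_pi:
  fixes n :: nat
  assumes "n > 0"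
  shows "primitive (\<lambda>x. cos (real n * x)) pi = 0"
proof -
  have "primitive (\<lambda>x. cos (real n * x)) pi = sin (real n * pi) / real n"
    by (rule primitive_unique) (use assms in \<open>auto intro!: derivative_eq_intros continuous_intros\<close>)
  then show ?thesis by simp
qed

lemma primitive_cos_squared_pi:
  fixes n :: nat
  assumes "n > 0"
  shows "primitive (\<lambda>x. cos (real n * x) * cos (real n * x)) pi = pi / 2"
proof -
  let ?F = "\<lambda>x. (x + sin (real n * x) * cos (real n * x) / real n) / 2"
  have "primitive (\<lambda>x. cos (real n * x) * cos (real n * x)) pi = ?F pi"
  proof (rule primitive_unique)
    show "continuous_on UNIV (\<lambda>x. cos (real n * x) * cos (real n * x))"
      by (intro continuous_intros)
    fix x :: real
    have "(?F has_real_derivative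
       (1 + (cos (real n * x) * cos (real n * x) - sin (real n * x) * sin (real n * x))) / 2) (at x)"
      using assms by (auto intro!: derivative_eq_intros simp: field_simps)
    moreover have "sin (real n * x) * sin (real n * x) = 1 - cos (real n * x) * cos (real n * x)"
      using sin_cos_squared_add3[of "real n * x"] by linarith
    ultimately show "(?F has_real_derivative cos (real n * x) * cos (real n * x)) (at x)"
      by simp
  qed simp
  then show ?thesis by simp
qed

text \<open>On \<open>[0, \<pi>]\<close> the functions \<open>1\<close> and \<open>cos (n x)\<close>
  are orthogonal with squared norms \<open>pi\<close> and \<open>pi / 2\<close>, which explains the
  coefficients \<open>1 / pi\<close> and \<open>2 / pi\<close> of the projection.\<close>

lemma even_extension_orthogonal:
  assumes n: "n > 0"
  shows "primitive (even_extension n f) pi = 0"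
    and "primitive (\<lambda>x. even_extension n f x * cos (real n * x)) pi = 0"
proof -
  let ?c = "\<lambda>x. cos (real n * x)"
  let ?a = "bcf_integral f" and ?b = "bcf_integral (bcf_mult f (bcf_cos n))"
  have fc: "continuous_on UNIV f" "continuous_on UNIV (\<lambda>x. f x * ?c x)"
    by (intro continuous_on_apply_bcontfun continuous_intros continuous_on_mult[OF continuous_on_apply_bcontfun])+
  have cc: "continuous_on UNIV ?c" "continuous_on UNIV (\<lambda>x. ?c x * ?c x)" "continuous_on UNIV (\<lambda>x. 1::real)"
    by (intro continuous_intros)+
  have 1: "primitive (\<lambda>x. 1) pi = pi"
    by (rule primitive_unique) (auto intro!: derivative_eq_intros)
  note 2 = primitive_cos_pi[OF n] and 3 = primitive_cos_squared_pi[OF n]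
  have a: "primitive f pi = ?a" by (simp add: bcf_integral)
  have b: "primitive (\<lambda>x. f x * ?c x) pi = ?b"
    unfolding bcf_integral by (rule arg_cong2[where f=primitive]) (simp_all add: fun_eq_iff)
  have ext: "even_extension n f t = 1 * f t + (-1) * (?a / pi * 1 + 2 / pi * ?b * ?c t)" if "0 < t" "t < pi" for t
    using that by (simp add: even_extension_def arccos_cos)
  have "primitive (even_extension n f) pi = primitive (\<lambda>t. 1 * f t + (-1) * (?a / pi * 1 + 2 / pi * ?b * ?c t)) pi"
    by (rule primitive_cong) (use ext in auto)
  also have "\<dots> = 1 * primitive f pi + (-1) * primitive (\<lambda>t. ?a / pi * 1 + 2 / pi * ?b * ?c t) pi"
    by (intro primitive_comb fc continuous_intros)
  also have "primitive (\<lambda>t. ?a / pi * 1 + 2 / pi * ?b * ?c t) pi = ?a / pi * primitive (\<lambda>x. 1) pi + 2 / pi * ?b * primitive ?c pi"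
    by (intro primitive_comb cc)
  finally show "primitive (even_extension n f) pi = 0"
    unfolding 1 2 a by simp
  have "primitive (\<lambda>x. even_extension n f x * ?c x) pi
      = primitive (\<lambda>t. 1 * (f t * ?c t) + (-1) * (?a / pi * ?c t + 2 / pi * ?b * (?c t * ?c t))) pi"
    by (rule primitive_cong) (simp_all only: ext, simp_all add: algebra_simps)
  also have "\<dots> = 1 * primitive (\<lambda>t. f t * ?c t) pi + (-1) * primitive (\<lambda>t. ?a / pi * ?c t + 2 / pi * ?b * (?c t * ?c t)) pi"
    by (intro primitive_comb fc continuous_intros)
  also have "primitive (\<lambda>t. ?a / pi * ?c t + 2 / pi * ?b * (?c t * ?c t)) pi
      = ?a / pi * primitive ?c pi + 2 / pi * ?b * primitive (\<lambda>t. ?c t * ?c t) pi"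
    by (intro primitive_comb cc)
  finally show "primitive (\<lambda>x. even_extension n f x * ?c x) pi = 0"
    unfolding 2 3 b by simp
qed

section \<open>The periodic response as a bounded linear map into the odd Sobolev space\<close>

text \<open>Thanks to the projection the response is periodic for every \<open>f\<close>, so the map
  is linear on the whole space. For reduced solutions with small \<open>w * m\<close> the projection
  changes nothing, by \<open>reduced_solution_orthogonal\<close>.\<close>

definition h3_response :: "nat \<Rightarrow> bcf \<Rightarrow> h3_odd" where
  "h3_response n f = Abs_h3_odd (oscillator 0 (real n) (even_extension n f))"

lemma
  assumes n: "n > 0"
  shows h3_fun_response: "h3_fun (h3_response n f) = oscillator 0 (real n) (even_extension n f)"
    and weak_deriv_response: "j \<le> 3 \<Longrightarrow>
      AE x in lborel. weak_deriv j (h3_fun (h3_response n f)) x = oscillator j (real n) (even_extension n f) x"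
proof -
  let ?u = "\<lambda>j. oscillator j (real n) (even_extension n f)"
  have D: "(?u j has_real_derivative ?u (Suc j) x) (at x)" if "j < 3" for j x
    using n that by (intro oscillator_deriv continuous_on_even_extension) auto
  have c: "continuous_on UNIV (?u j)" if "j \<le> 3" for j
    using n that by (intro continuous_on_oscillator continuous_on_even_extension) auto
  note p = oscillator_periodic[OF continuous_on_even_extension even_extension_sym(2,1) even_extension_orthogonal[OF n]]
  show eq: "h3_fun (h3_response n f) = ?u 0"
    unfolding h3_response_def by (rule h3_oddI[of ?u, OF D c p(1,2)])
  show "AE x in lborel. weak_deriv j (h3_fun (h3_response n f)) x = ?u j x" if "j \<le> 3"
    unfolding eq using sobolev_classical(2)[of 3 ?u, OF D c p(1) that] .
qed

lemma oscillator_comb: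
  assumes f: "continuous_on UNIV f" and g: "continuous_on UNIV g"
  shows "oscillator 0 k (\<lambda>x. a * f x + b * g x) x = a * oscillator 0 k f x + b * oscillator 0 k g x"
proof -
  have "(\<lambda>x. (a * f x + b * g x) * cos (k * x)) = (\<lambda>x. a * (f x * cos (k * x)) + b * (g x * cos (k * x)))"
    "(\<lambda>x. (a * f x + b * g x) * sin (k * x)) = (\<lambda>x. a * (f x * sin (k * x)) + b * (g x * sin (k * x)))"
    by (simp_all add: fun_eq_iff algebra_simps)
  moreover have "continuous_on UNIV (\<lambda>x. f x * cos (k * x))" "continuous_on UNIV (\<lambda>x. g x * cos (k * x))"
    "continuous_on UNIV (\<lambda>x. f x * sin (k * x))" "continuous_on UNIV (\<lambda>x. g x * sin (k * x))"
    by (intro continuous_intros f g)+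
  ultimately show ?thesis
    by (simp add: oscillator_def Let_def primitive_comb f g algebra_simps add_divide_distrib diff_divide_distrib)
qed

text \<open>The primitives are at most \<open>2 * pi * c\<close> on one period; a single crude sum
  dominates all orders, and \<open>k \<ge> 1\<close> allows dropping the divisors.\<close>

lemma oscillator_bound:
  assumes g: "continuous_on UNIV g" and c: "\<And>x. \<bar>g x\<bar> \<le> c" and x: "0 \<le> x" "x \<le> 2*pi" and k: "k \<ge> 1"
  shows "\<bar>oscillator j k g x\<bar> \<le> (1 + (3 + 2 * k) * (2*pi)) * c"
proof -
  have c0: "c \<ge> 0" using c[of 0] by linarith
  have le: "\<bar>primitive h x\<bar> \<le> 2*pi*c" if "continuous_on UNIV h" "\<And>x. \<bar>h x\<bar> \<le> c" for h
    using primitive_bound[OF x(1) that] mult_left_mono[OF x(2) c0] by (simp add: mult.commute)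
  define G where "G = primitive g x"
  define C where "C = primitive (\<lambda>t. g t * cos (k * t)) x"
  define S where "S = primitive (\<lambda>t. g t * sin (k * t)) x"
  have G: "\<bar>G\<bar> \<le> 2*pi*c" unfolding G_def by (intro le g c)
  have t: "\<bar>y * z\<bar> \<le> d" if "\<bar>y\<bar> \<le> d" "\<bar>z\<bar> \<le> 1" for y z d :: real
    using mult_mono[OF that] that(1) by (simp add: abs_mult)
  have C: "\<bar>C\<bar> \<le> 2*pi*c" unfolding C_def by (intro le t c continuous_intros g) auto
  have S: "\<bar>S\<bar> \<le> 2*pi*c" unfolding S_def by (intro le t c continuous_intros g) auto
  have q: "\<bar>cos (k * x) * C\<bar> \<le> 2*pi*c" "\<bar>sin (k * x) * C\<bar> \<le> 2*pi*c"
    "\<bar>cos (k * x) * S\<bar> \<le> 2*pi*c" "\<bar>sin (k * x) * S\<bar> \<le> 2*pi*c"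
    by (subst mult.commute, rule t; use C S in simp)+
  have div: "\<bar>y / z\<bar> \<le> d" if "\<bar>y\<bar> \<le> d" "z \<ge> 1" for y z d :: real
  proof -
    have "\<bar>y / z\<bar> \<le> \<bar>y\<bar> / 1" unfolding abs_divide using that(2) by (intro divide_left_mono) auto
    then show ?thesis using that(1) by simp
  qed
  have p0: "0 \<le> 2*pi*c" using c0 by simp
  have kp: "2*pi*c \<le> k * (2*pi*c)" using mult_right_mono[OF k p0] by simp
  define M where "M = c + 3 * (2*pi*c) + 2 * (k * (2*pi*c))"
  have "(1 + (3 + 2 * k) * (2*pi)) * c = M" by (simp add: M_def algebra_simps)
  moreover have "\<bar>oscillator j k g x\<bar> \<le> M"
  proof -
    consider "j = 0" | "j = 1" | "j = 2" | "j > 2" by linarith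
    then show ?thesis
    proof cases
      case 1
      have "\<bar>(G - cos (k * x) * C - sin (k * x) * S) / k\<^sup>2\<bar> \<le> M"
        by (intro div one_le_power k) (use q G c0 p0 kp in \<open>unfold M_def, linarith\<close>)
      then show ?thesis by (simp add: 1 oscillator_def G_def C_def S_def Let_def)
    next
      case 2
      have "\<bar>(sin (k * x) * C - cos (k * x) * S) / k\<bar> \<le> M"
        by (intro div k) (use q c0 p0 kp in \<open>unfold M_def, linarith\<close>)
      then show ?thesis by (simp add: 2 oscillator_def C_def S_def Let_def)
    next
      case 3
      have "\<bar>cos (k * x) * C + sin (k * x) * S\<bar> \<le> M"
        using q c0 p0 kp unfolding M_def by linarith
      then show ?thesis by (simp add: 3 oscillator_def C_def S_def Let_def)
    next
      case 4
      have "\<bar>sin (k * x) * C - cos (k * x) * S\<bar> \<le> 2 * (2*pi*c)" using q by linarith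
      then have "\<bar>k * (sin (k * x) * C - cos (k * x) * S)\<bar> \<le> k * (2 * (2*pi*c))"
        using k by (simp add: abs_mult)
      then have "\<bar>g x - k * (sin (k * x) * C - cos (k * x) * S)\<bar> \<le> M"
        using c[of x] p0 unfolding M_def by linarith
      then show ?thesis using 4 by (simp add: oscillator_def C_def S_def Let_def)
    qed
  qed
  ultimately show ?thesis by simp
qed

text \<open>Boundedness transfers the C1 dependence of \<open>f\<close> on \<open>w\<close> from the
  sup norm to the Sobolev norm.\<close>

lemma bounded_linear_h3_response:
  assumes n: "n > 0"
  shows "bounded_linear (h3_response n)"
proof
  fix f g :: bcf and r :: real
  note * = oscillator_comb[OF continuous_on_even_extension continuous_on_even_extension]
  have "even_extension n (f + g) = (\<lambda>x. 1 * even_extension n f x + 1 * even_extension n g x)"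
    using even_extension_comb[of n 1 f 1 g] by (intro ext) simp
  then have "oscillator 0 n (even_extension n (f + g)) x
      = oscillator 0 n (even_extension n f) x + oscillator 0 n (even_extension n g) x" for x
    using *[of n 1 n f 1 n g x] by simp
  then show "h3_response n (f + g) = h3_response n f + h3_response n g"
    by (simp add: h3_fun_inject[symmetric] h3_fun_plus h3_fun_response[OF n] fun_eq_iff)
  have "even_extension n (r *\<^sub>R f) = (\<lambda>x. r * even_extension n f x + 0 * even_extension n f x)"
    using even_extension_comb[of n r f 0 f] by (intro ext) simp
  then have "oscillator 0 n (even_extension n (r *\<^sub>R f)) x = r * oscillator 0 n (even_extension n f) x" for x
    using *[of n r n f 0 n f x] by simp
  then show "h3_response n (r *\<^sub>R f) = r *\<^sub>R h3_response n f"
    by (simp add: h3_fun_inject[symmetric] h3_fun_scaleR h3_fun_response[OF n] fun_eq_iff)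
  let ?K = "(1 + (3 + 2 * real n) * (2*pi)) * 4"
  show "\<exists>K. \<forall>f. norm (h3_response n f) \<le> norm f * K"
  proof (intro exI[of _ "sqrt (8 * pi) * ?K"] allI)
    fix f
    have "norm (h3_response n f) \<le> sqrt (8 * pi) * (?K * norm f)"
    proof (rule h3_odd_norm_bound[OF weak_deriv_response[OF n]])
      show "\<bar>oscillator j (real n) (even_extension n f) x\<bar> \<le> ?K * norm f" if "0 \<le> x" "x \<le> 2*pi" for j x
        using oscillator_bound[OF continuous_on_even_extension even_extension_bound that, of "real n" j n f] n
        by (simp add: algebra_simps)
    qed auto
    then show "norm (h3_response n f) \<le> norm f * (sqrt (8 * pi) * ?K)" by (simp add: mult_ac)
  qed
qed

section \<open>The tangent angle and its classical derivatives\<close>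

text \<open>Orders up to 3 are the derivatives of \<open>sin (k x)\<close>; larger \<open>j\<close>
  merely repeats the third.\<close>

definition sin_deriv :: "nat \<Rightarrow> real \<Rightarrow> real \<Rightarrow> real" where
  "sin_deriv j k x = (if j = 0 then sin (k * x) else if j = 1 then k * cos (k * x)
     else if j = 2 then - (k\<^sup>2 * sin (k * x)) else - (k ^ 3 * cos (k * x)))"

lemma sin_deriv_deriv: "j < 3 \<Longrightarrow> (sin_deriv j k has_real_derivative sin_deriv (Suc j) k x) (at x)"
proof -
  assume "j < 3"
  then consider "j = 0" | "j = 1" | "j = 2" by linarith
  then show ?thesis
    by cases (auto simp: sin_deriv_def[abs_def] power2_eq_square power3_eq_cube intro!: derivative_eq_intros)
qed

lemma continuous_on_sin_deriv: "continuous_on A (sin_deriv j k)"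
  by (cases "j = 0"; cases "j = 1"; cases "j = 2")
    (auto simp: sin_deriv_def[abs_def] intro!: continuous_intros)

lemma sin_deriv_periodic: "periodic_fun_simple (sin_deriv j (real n)) (2*pi)"
  by (simp add: periodic_fun_simple_def sin_deriv_def trig_periodic)

definition h3_sine :: "nat \<Rightarrow> h3_odd" where "h3_sine n = Abs_h3_odd (sin_deriv 0 (real n))"

lemma h3_fun_sine: "h3_fun (h3_sine n) = sin_deriv 0 (real n)"
  unfolding h3_sine_def
  by (rule h3_oddI[of "\<lambda>j. sin_deriv j (real n)", OF sin_deriv_deriv continuous_on_sin_deriv sin_deriv_periodic])
    (simp_all add: sin_deriv_def)

text \<open>The outer factor \<open>w\<close> is the amplitude in
  \<open>\<theta> = w \<phi>\<close>; the inner one belongs to the forcing \<open>w f\<close> of the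
  profile.\<close>

definition flame_angle :: "nat \<Rightarrow> real \<Rightarrow> bcf \<Rightarrow> h3_odd" where
  "flame_angle n w f = w *\<^sub>R (h3_sine n + w *\<^sub>R h3_response n f)"

definition angle_deriv :: "nat \<Rightarrow> nat \<Rightarrow> real \<Rightarrow> bcf \<Rightarrow> real \<Rightarrow> real" where
  "angle_deriv j n w f x = w * (sin_deriv j (real n) x + w * oscillator j (real n) (even_extension n f) x)"

lemma
  assumes n: "n > 0"
  shows h3_fun_flame_angle: "h3_fun (flame_angle n w f) = angle_deriv 0 n w f"
    and angle_deriv_deriv: "j < 3 \<Longrightarrow> (angle_deriv j n w f has_real_derivative angle_deriv (Suc j) n w f x) (at x)"
    and continuous_on_angle_deriv: "j \<le> 3 \<Longrightarrow> continuous_on A (angle_deriv j n w f)"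
    and angle_deriv_periodic: "periodic_fun_simple (angle_deriv j n w f) (2*pi)"
    and angle_deriv_even: "angle_deriv 1 n w f (-x) = angle_deriv 1 n w f x"
      "angle_deriv 3 n w f (-x) = angle_deriv 3 n w f x"
    and angle_deriv_odd: "angle_deriv 0 n w f (-x) = - angle_deriv 0 n w f x"
    and weak_deriv_flame_angle: "j \<le> 3 \<Longrightarrow>
      AE x in lborel. weak_deriv j (h3_fun (flame_angle n w f)) x = angle_deriv j n w f x"
proof -
  note p = oscillator_periodic[OF continuous_on_even_extension even_extension_sym(2,1) even_extension_orthogonal[OF n]]
  show eq: "h3_fun (flame_angle n w f) = angle_deriv 0 n w f" for f
    by (simp add: flame_angle_def h3_fun_scaleR h3_fun_plus h3_fun_sine h3_fun_response[OF n]
        angle_deriv_def fun_eq_iff)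
  show D: "(angle_deriv j n w f has_real_derivative angle_deriv (Suc j) n w f x) (at x)" if "j < 3" for j x
  proof -
    have "(oscillator j (real n) (even_extension n f) has_real_derivative
        oscillator (Suc j) (real n) (even_extension n f) x) (at x)"
      using n that by (intro oscillator_deriv continuous_on_even_extension) auto
    from DERIV_cmult[OF DERIV_add[OF sin_deriv_deriv[OF that] DERIV_cmult[OF this]]]
    show ?thesis by (simp add: angle_deriv_def[abs_def])
  qed
  show c: "continuous_on A (angle_deriv j n w f)" if "j \<le> 3" for j A
  proof -
    have "continuous_on A (oscillator j (real n) (even_extension n f))"
      using n that by (intro continuous_on_oscillator continuous_on_even_extension) auto
    then show ?thesis
      unfolding angle_deriv_def[abs_def] by (intro continuous_intros continuous_on_sin_deriv)
  qed
  show per: "periodic_fun_simple (angle_deriv j n w f) (2*pi)" for j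
    using p(1)[of j f] sin_deriv_periodic[of j n] by (simp add: periodic_fun_simple_def angle_deriv_def)
  show "angle_deriv 0 n w f (-x) = - angle_deriv 0 n w f x"
    using p(2)[of f x] by (simp add: angle_deriv_def sin_deriv_def algebra_simps)
  show "angle_deriv 1 n w f (-x) = angle_deriv 1 n w f x" "angle_deriv 3 n w f (-x) = angle_deriv 3 n w f x"
    using p(3)[of f x] n by (simp_all add: angle_deriv_def sin_deriv_def oscillator_ode even_extension_sym(1))
  show "AE x in lborel. weak_deriv j (h3_fun (flame_angle n w f)) x = angle_deriv j n w f x" if "j \<le> 3"
    unfolding eq using sobolev_classical(2)[of 3 "\<lambda>j. angle_deriv j n w f", OF D c per that] .
qed

text \<open>The slope at 0 is \<open>w * n\<close>, since the oscillator part has slope 0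
  there.\<close>

lemma flame_angle_nonzero:
  assumes "n > 0" "w \<noteq> 0"
  shows "flame_angle n w f \<noteq> 0"
proof
  assume "flame_angle n w f = 0"
  then have "angle_deriv 0 n w f = (\<lambda>_. 0)"
    using h3_fun_flame_angle[OF assms(1)] by (metis h3_fun_zero)
  then have "((\<lambda>_. 0) has_real_derivative angle_deriv 1 n w f 0) (at 0)"
    using angle_deriv_deriv[OF assms(1), of 0 w f 0] by simp
  then have "angle_deriv 1 n w f 0 = 0"
    by (rule DERIV_unique[OF _ DERIV_const])
  then show False using assms by (simp add: angle_deriv_def sin_deriv_def)
qed

text \<open>Reduces an identity between even periodic functions on the line to
  \<open>[0, \<pi>]\<close>: shift \<open>x\<close> into \<open>[-\<pi>, \<pi>]\<close>, then
  reflect.\<close>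

lemma even_periodic_arccos_cos:
  assumes per: "periodic_fun_simple F (2*pi)" and ev: "\<And>x::real. F (-x) = F x"
  shows "F (arccos (cos x)) = F x"
proof -
  interpret periodic_fun_simple F "2*pi" by (rule per)
  obtain y where y: "-pi \<le> y" "y \<le> pi" and "sin y = sin x" "cos y = cos x"
    using sincos_principal_value[of x] by (auto dest: less_imp_le)
  then obtain i where "x = y + of_int i * (2*pi)"
    using sin_cos_eq_iff[of x y] by (auto simp: mult_ac)
  then have "F x = F y" by (simp add: plus_of_int)
  moreover have "F (arccos (cos y)) = F y"
    using y ev[of y] by (cases "0 \<le> y") (auto simp: arccos_cos arccos_cos2)
  ultimately show ?thesis using \<open>cos y = cos x\<close> by simp
qed

section \<open>From the blown-up problem to the flame front\<close>

lemma oscillator_cong: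
  assumes "0 \<le> x" "x \<le> pi" "\<And>t. 0 \<le> t \<Longrightarrow> t \<le> pi \<Longrightarrow> f t = g t"
  shows "oscillator j k f x = oscillator j k g x"
proof -
  have "primitive (\<lambda>t. f t * h t) x = primitive (\<lambda>t. g t * h t) x" for h
    using assms by (intro primitive_cong) auto
  moreover have "primitive f x = primitive g x"
    using assms by (intro primitive_cong) auto
  ultimately show ?thesis using assms by (simp add: oscillator_def Let_def)
qed

lemma bcf_integral_cos:
  assumes "n > 0"
  shows "bcf_integral (bcf_cos (real n)) = 0"
    and "bcf_integral (bcf_mult (bcf_cos (real n)) (bcf_cos (real n))) = pi / 2"
  using primitive_cos_pi[OF assms] primitive_cos_squared_pi[OF assms]
  by (simp_all add: bcf_integral bcf_cos_apply[abs_def] bcf_mult_apply[abs_def])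

lemma bcf_integral_oscillator:
  assumes "k \<noteq> 0"
  shows "bcf_integral (bcf_oscillator k f) = oscillator 0 k f pi"
proof -
  have "primitive (bcf_oscillator k f) pi = primitive (oscillator 1 k f) pi"
    by (rule primitive_cong) (auto simp: bcf_oscillator_apply)
  then show ?thesis
    using primitive_oscillator[OF continuous_on_apply_bcontfun assms, of f pi] by (simp add: bcf_integral)
qed

text \<open>The equation for \<open>m\<close> gives orthogonality to the cosine directly. The
  equation for \<open>b\<close> only says that \<open>h\<close> has mean zero; combined with the
  mean of the slope, \<open>w / k\<^sup>2\<close> times that of \<open>f\<close>, it gives
  \<open>(k\<^sup>2 + w m) \<integral> f = 0\<close>, and \<open>small\<close> excludes a zero
  factor.\<close>

lemma reduced_solution_orthogonal:
  assumes n: "n > 0" and r: "reduced_solution (real n) w d b m f"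
    and small: "\<bar>w * m\<bar> < (real n)\<^sup>2"
  shows "bcf_integral f = 0" "bcf_integral (bcf_mult f (bcf_cos (real n))) = 0"
proof -
  define k where "k = real n"
  have k: "k > 0" using n by (simp add: k_def)
  interpret I: bounded_linear bcf_integral by (rule bounded_linear_bcf_integral)
  interpret M: bounded_bilinear bcf_mult by (rule bounded_bilinear_bcf_mult)
  define B where "B = (1 + w\<^sup>2 * b) ^ 3 / 4"
  define h where "h = bcf_height w d b"
  define p where "p = bcf_slope k w f"
  define X where "X = bcf_integral (bcf_mult h (bcf_cos k))"
  define Y where "Y = bcf_integral (bcf_mult (bcf_oscillator k f) (bcf_cos k))"
  have beq: "b = (bcf_integral d + w\<^sup>2 * b * bcf_integral d) / pi"
    and m: "m = 2 / (k * pi) * (B * X - w * m * Y)"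
    and f: "f = B *\<^sub>R h - m *\<^sub>R p"
    using r unfolding reduced_solution_def B_def h_def p_def X_def Y_def k_def by blast+
  have "bcf_integral (bcf_mult p (bcf_cos k)) = k * (pi / 2) + w * Y"
    using bcf_integral_cos(2)[OF n]
    by (simp add: p_def bcf_slope_def M.add_left M.scaleR_left I.add I.scaleR Y_def k_def)
  moreover have "bcf_integral (bcf_mult f (bcf_cos k)) = B * X - m * bcf_integral (bcf_mult p (bcf_cos k))"
    by (subst f) (simp add: M.diff_left M.scaleR_left I.diff I.scaleR X_def)
  moreover have "m * (k * pi / 2) = B * X - w * m * Y"
  proof -
    have "m * (k * pi / 2) = 2 / (k * pi) * (B * X - w * m * Y) * (k * pi / 2)" using m by simp
    then show ?thesis using k by simp
  qed
  ultimately have c: "bcf_integral (bcf_mult f (bcf_cos k)) = 0"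
    by (simp add: algebra_simps)
  then show "bcf_integral (bcf_mult f (bcf_cos (real n))) = 0" by (simp add: k_def)
  have "bcf_integral (const_bcontfun 1) = pi"
    unfolding bcf_integral by (rule primitive_unique) (auto simp: const_bcontfun.rep_eq intro!: derivative_eq_intros)
  then have h0: "bcf_integral h = 0"
    using beq by (simp add: h_def bcf_height_def I.diff I.add I.scaleR field_simps)
  \<comment> \<open>At \<open>pi\<close> the cosine primitive vanishes by \<open>c\<close> and the
    sine primitive is multiplied by \<open>sin (k * pi) = 0\<close>, so only the mean of
    \<open>f\<close> survives in the oscillator.\<close>
  have "primitive (\<lambda>t. f t * cos (k * t)) pi = 0"
    using c unfolding bcf_integral by (simp add: bcf_mult_def[symmetric] bcf_mult_apply[abs_def])
  moreover have "sin (k * pi) = 0" by (simp add: k_def)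
  ultimately have "oscillator 0 k f pi = bcf_integral f / k\<^sup>2"
    by (simp add: oscillator_def Let_def bcf_integral)
  then have "bcf_integral p = w * bcf_integral f / k\<^sup>2"
    using bcf_integral_cos(1)[OF n] k
    by (simp add: p_def bcf_slope_def I.add I.scaleR bcf_integral_oscillator k_def[symmetric])
  moreover have "bcf_integral f = B * bcf_integral h - m * bcf_integral p"
    by (subst f) (simp add: I.diff I.scaleR)
  ultimately have "bcf_integral f * (k\<^sup>2 + w * m) = 0"
    using h0 k by (simp add: field_simps)
  moreover have "k\<^sup>2 + w * m \<noteq> 0" using small by (auto simp: k_def)
  ultimately show "bcf_integral f = 0" by simp
qed

text \<open>The differential equation is first proved with \<open>\<beta>\<close> in place of
  \<open>s_sigma\<close>. Integrating it over a period then shows that the two agree, after which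
  \<open>flame_G\<close> is \<open>4 / \<beta> ^ 3\<close> times its left side.\<close>

lemma reduced_solution_flame:
  assumes n: "n > 0" and r: "reduced_solution (real n) w d b m f"
    and small: "\<bar>w * m\<bar> < (real n)\<^sup>2" and \<beta>: "\<beta> = 1 + w\<^sup>2 * b" "\<beta> > 0"
    and \<alpha>: "\<alpha> = 1 + 4 * ((real n)\<^sup>2 + w * m) / \<beta>\<^sup>2"
  shows "0 < cos_integral (flame_angle n w f)"
    and "AE \<sigma> in lborel. flame_G (flame_angle n w f) \<beta> \<alpha> \<sigma> = 0"
proof -
  define k where "k = real n"
  have k: "k > 0" using n by (simp add: k_def)
  define g where "g = even_extension n f"
  define p where "p = bcf_slope k w f"
  define S where "S = bcf_primitive (p - w\<^sup>2 *\<^sub>R bcf_mult d p)"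
  define h where "h = bcf_height w d b"
  let ?T = "\<lambda>j. angle_deriv j n w f"
  note T' = angle_deriv_deriv[OF n, of _ w f]
  have d: "d = bcf_primitive (bcf_mult S p)" and f: "f = (\<beta> ^ 3 / 4) *\<^sub>R h - m *\<^sub>R p"
    using r unfolding reduced_solution_def S_def h_def p_def k_def \<beta>(1) by blast+
  \<comment> \<open>Both projection terms of the extension vanish by orthogonality.\<close>
  have g: "g x = f x" if "0 \<le> x" "x \<le> pi" for x
    using that reduced_solution_orthogonal[OF n r small] by (simp add: g_def even_extension_def arccos_cos)
  have T1: "?T 1 x = w * p x" if "0 \<le> x" "x \<le> pi" for x
    using oscillator_cong[of x f g 1 k, OF that] g that
    by (simp add: angle_deriv_def sin_deriv_def p_def bcf_slope_def bcf_oscillator_apply g_def k_def)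
  have trig: "cos (?T 0 x) = 1 - w\<^sup>2 * d x" if x: "0 \<le> x" "x \<le> pi" for x
  proof -
    let ?C = "\<lambda>x. 1 - w\<^sup>2 * d x" and ?S = "\<lambda>x. w * S x"
    have D: "(?T 0 has_real_derivative w * p y) (at y within {0..pi})"
      "(d has_real_derivative S y * p y) (at y within {0..pi})"
      "(S has_real_derivative p y - w\<^sup>2 * (d y * p y)) (at y within {0..pi})"
      if "y \<in> {0..pi}" for y
    proof -
      show "(?T 0 has_real_derivative w * p y) (at y within {0..pi})"
        using T'[of 0 y] T1[of y] that by (auto intro: has_field_derivative_at_within)
      show "(d has_real_derivative S y * p y) (at y within {0..pi})"
        using bcf_primitive_deriv[OF that, of "bcf_mult S p"] by (simp add: d[symmetric])
      show "(S has_real_derivative p y - w\<^sup>2 * (d y * p y)) (at y within {0..pi})"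
        using bcf_primitive_deriv[OF that, of "p - w\<^sup>2 *\<^sub>R bcf_mult d p"] by (simp add: S_def)
    qed
    have 0: "?T 0 0 = 0" "d 0 = 0" "S 0 = 0"
      by (simp_all add: angle_deriv_def sin_deriv_def S_def bcf_primitive_apply)
        (subst d, simp add: bcf_primitive_apply)
    \<comment> \<open>Real and imaginary part of \<open>(C + i S) exp (- i \<theta>)\<close>. The
      equations for \<open>d\<close> and \<open>S\<close> say
      \<open>(C + i S)' = i \<theta>' (C + i S)\<close>, so this product keeps its initial value
      1.\<close>
    define E1 where "E1 = (\<lambda>x. ?C x * cos (?T 0 x) + ?S x * sin (?T 0 x))"
    define E2 where "E2 = (\<lambda>x. ?S x * cos (?T 0 x) - ?C x * sin (?T 0 x))"
    have "(E1 has_real_derivative 0) (at y within {0..pi})" "(E2 has_real_derivative 0) (at y within {0..pi})"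
      if "y \<in> {0..pi}" for y
      unfolding E1_def E2_def
      by (auto intro!: derivative_eq_intros D[OF that] simp: power2_eq_square algebra_simps)
    then have "\<exists>c. \<forall>y\<in>{0..pi}. E1 y = c" "\<exists>c. \<forall>y\<in>{0..pi}. E2 y = c"
      using has_field_derivative_zero_constant[OF convex_real_interval(5), of 0 pi E1]
        has_field_derivative_zero_constant[OF convex_real_interval(5), of 0 pi E2] by blast+
    then have "E1 x = E1 0" "E2 x = E2 0"
      using x by (metis atLeastAtMost_iff order_refl pi_ge_zero)+
    then have e: "?C x * cos (?T 0 x) + ?S x * sin (?T 0 x) = 1" "?S x * cos (?T 0 x) - ?C x * sin (?T 0 x) = 0"
      by (simp_all add: E1_def E2_def 0)
    \<comment> \<open>Rotating back by \<open>\<theta>\<close> recovers \<open>C\<close> from the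
      two constants.\<close>
    have "c * (C * c + S * s) - s * (S * c - C * s) = C * (c * c + s * s)" for c s C S :: real
      by (simp add: algebra_simps)
    from this[of "cos (?T 0 x)" "?C x" "?S x" "sin (?T 0 x)"] show ?thesis
      unfolding e sin_cos_squared_add3 by simp
  qed
  define F where "F x = ?T 3 x + (k\<^sup>2 + w * m) * ?T 1 x + \<beta> ^ 3 / 4 * (1 - \<beta> * cos (?T 0 x))" for x
  have F0: "F x = 0" if x: "0 \<le> x" "x \<le> pi" for x
  proof -
    define c where "c = cos (k * x)"
    define q where "q = oscillator 1 k g x"
    have "?T 3 x = w * (- (k ^ 3 * c) + w * (f x - k\<^sup>2 * q))" "?T 1 x = w * (k * c + w * q)"
      using k g[OF x] oscillator_ode[of k g x]
      by (simp_all add: angle_deriv_def sin_deriv_def k_def[symmetric] g_def[symmetric] c_def q_def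
          del: One_nat_def)
    then have "?T 3 x = w\<^sup>2 * f x - k\<^sup>2 * ?T 1 x"
      by (simp only: power2_eq_square power3_eq_cube) (simp add: algebra_simps)
    also have "f x = \<beta> ^ 3 / 4 * h x - m * p x" by (subst f) simp
    also have "w\<^sup>2 * (\<beta> ^ 3 / 4 * h x - m * p x) = \<beta> ^ 3 / 4 * (w\<^sup>2 * h x) - w * m * ?T 1 x"
      by (simp add: T1[OF x] power2_eq_square algebra_simps del: One_nat_def)
    also have "w\<^sup>2 * h x = \<beta> * cos (?T 0 x) - 1"
      by (simp add: h_def bcf_height_def trig[OF x] \<beta>(1) const_bcontfun.rep_eq algebra_simps)
    finally show ?thesis by (simp add: F_def algebra_simps del: One_nat_def)
  qed
  \<comment> \<open>The angle is odd, so its derivatives of odd order and its cosine are even; hence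
    the identity on \<open>[0, \<pi>]\<close> extends to the line.\<close>
  have F: "F x = 0" for x
  proof -
    have "periodic_fun_simple F (2*pi)"
      using angle_deriv_periodic[OF n, of _ w f] by (simp add: F_def periodic_fun_simple_def)
    moreover have "F (-x) = F x" for x
      by (simp only: F_def angle_deriv_even[OF n] angle_deriv_odd[OF n] cos_minus)
    ultimately have "F x = F (arccos (cos x))"
      by (rule even_periodic_arccos_cos[symmetric])
    then show ?thesis using F0 by (simp add: arccos_lbound arccos_ubound)
  qed
  have "cos_integral (flame_angle n w f) = (LINT x:{0..2*pi}|lborel. cos (?T 0 x))"
    by (simp add: cos_integral_def h3_fun_flame_angle[OF n])
  also have "\<dots> = 2*pi / \<beta>"
  proof -
    \<comment> \<open>A primitive of \<open>cos \<theta>\<close>, read off by solving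
      \<open>F x = 0\<close> for the cosine. Over a period only its linear part
      \<open>x / \<beta>\<close> contributes.\<close>
    define \<Psi> where "\<Psi> x = 4 / \<beta> ^ 4 * (?T 2 x + (k\<^sup>2 + w * m) * ?T 0 x) + x / \<beta>" for x
    have "(LINT x:{0..2*pi}|lborel. cos (?T 0 x)) = \<Psi> (2*pi) - \<Psi> 0"
    proof (rule set_integral_FTC_period)
      show "continuous_on UNIV (\<lambda>x. cos (?T 0 x))"
        by (intro continuous_on_cos continuous_on_angle_deriv[OF n]) simp
      fix x
      have "(\<Psi> has_real_derivative 4 / \<beta> ^ 4 * (?T 3 x + (k\<^sup>2 + w * m) * ?T 1 x) + 1 / \<beta>) (at x)"
      proof -
        have "(?T 0 has_real_derivative ?T 1 x) (at x)" "(?T 2 has_real_derivative ?T 3 x) (at x)"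
          using T'[of 0 x] T'[of 2 x] by (simp_all add: numeral_3_eq_3 numeral_2_eq_2)
        then show ?thesis
          unfolding \<Psi>_def
          by (intro DERIV_add DERIV_cmult DERIV_cdivide DERIV_ident)
      qed
      moreover have "?T 3 x + (k\<^sup>2 + w * m) * ?T 1 x = \<beta> ^ 3 / 4 * (\<beta> * cos (?T 0 x) - 1)"
        using F[of x] by (simp add: F_def algebra_simps del: One_nat_def)
      moreover have "4 / \<beta> ^ 4 * (\<beta> ^ 3 / 4 * (\<beta> * cos (?T 0 x) - 1)) + 1 / \<beta> = cos (?T 0 x)"
        using \<beta>(2) by (simp add: field_simps power4_eq_xxxx power3_eq_cube)
      ultimately show "(\<Psi> has_real_derivative cos (?T 0 x)) (at x)" by (simp only:)
    qed
    also have "\<dots> = 2*pi / \<beta>"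
      using periodic_fun_simple_0_2pi[OF angle_deriv_periodic[OF n]] by (simp add: \<Psi>_def)
    finally show ?thesis .
  qed
  finally have ci: "cos_integral (flame_angle n w f) = 2*pi / \<beta>" .
  then show "0 < cos_integral (flame_angle n w f)" using \<beta>(2) by simp
  have s: "s_sigma (flame_angle n w f) = \<beta>" using ci \<beta>(2) by (simp add: s_sigma_def)
  have "AE x in lborel. weak_deriv 1 (h3_fun (flame_angle n w f)) x = ?T 1 x"
    "AE x in lborel. weak_deriv 3 (h3_fun (flame_angle n w f)) x = ?T 3 x"
    by (rule weak_deriv_flame_angle[OF n]; simp)+
  then show "AE \<sigma> in lborel. flame_G (flame_angle n w f) \<beta> \<alpha> \<sigma> = 0"
  proof eventually_elim
    case (elim x)
    have "flame_G (flame_angle n w f) \<beta> \<alpha> x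
        = 1 + (\<alpha> - 1) * ?T 1 x / \<beta> + 4 * ?T 3 x / \<beta> ^ 3 - \<beta> * cos (?T 0 x)"
      unfolding flame_G_def elim s by (simp add: h3_fun_flame_angle[OF n])
    also have "\<dots> = 4 / \<beta> ^ 3 * F x"
      using \<beta>(2) by (simp add: \<alpha> F_def k_def field_simps power2_eq_square power3_eq_cube del: One_nat_def)
    finally show ?case by (simp add: F)
  qed
qed

text \<open>The front is obtained by integrating its unit tangent, scaled by \<open>s_sigma\<close>,
  and lowering it at speed \<open>\<beta>\<close>. The definition of \<open>s_sigma\<close> makes
  \<open>x\<close> advance by \<open>2 * pi\<close> over a period.\<close>

lemma vertically_travelingI:
  assumes pos: "0 < cos_integral \<theta>" and G: "AE \<sigma> in lborel. flame_G \<theta> \<beta> \<alpha> \<sigma> = 0"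
  shows "vertically_traveling \<theta> \<beta> \<alpha>"
proof -
  let ?u = "h3_fun \<theta>" and ?s = "s_sigma \<theta>"
  have c: "continuous_on UNIV (\<lambda>x. cos (?u x))" "continuous_on UNIV (\<lambda>x. sin (?u x))"
    by (intro continuous_intros h3_fun_props)+
  have p: "periodic_fun_simple (\<lambda>x. cos (?u x)) (2*pi)" "periodic_fun_simple (\<lambda>x. sin (?u x)) (2*pi)"
    using L2_periodicD(2)[OF h3_fun_props(4)[of \<theta>]] by (simp_all add: periodic_fun_simple_def)
  have ci: "primitive (\<lambda>x. cos (?u x)) (2*pi) = cos_integral \<theta>"
    using set_integral_FTC_period[OF primitive_deriv c(1), OF c(1)] by (simp add: cos_integral_def)
  \<comment> \<open>The sine of the odd angle is odd and its primitive even, so the height returns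
    to its value after a period.\<close>
  have "primitive (\<lambda>x. sin (?u x)) (-x) = primitive (\<lambda>x. sin (?u x)) x" for x
    using primitive_even_odd[OF c(2), of "-1" x] by (simp add: h3_fun_props(3))
  then have si: "periodic_fun_simple (primitive (\<lambda>x. sin (?u x))) (2*pi)"
    by (intro primitive_periodic[OF c(2) p(2)]) simp
  define x where "x = (\<lambda>\<sigma> t::real. ?s * primitive (\<lambda>x. cos (?u x)) \<sigma>)"
  define y where "y = (\<lambda>\<sigma> t. ?s * primitive (\<lambda>x. sin (?u x)) \<sigma> - \<beta> * t)"
  have "flame_front_motion \<alpha> (\<lambda>_. \<theta>) x y (\<lambda>\<sigma> t. - \<beta> * cos (?u \<sigma>)) (\<lambda>\<sigma> t. - \<beta> * sin (?u \<sigma>))"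
    unfolding flame_front_motion_def
  proof (intro conjI allI)
    show "x (\<sigma> + 2*pi) t = x \<sigma> t + 2*pi" for \<sigma> t
      using pos by (simp add: x_def primitive_shift[OF c(1) p(1)] ci s_sigma_def distrib_left add_divide_distrib)
    show "y (\<sigma> + 2*pi) t = y \<sigma> t" for \<sigma> t
      using si by (simp add: y_def periodic_fun_simple_def)
    show "0 < cos_integral \<theta>" by (rule pos)
    show "((\<lambda>\<sigma>. x \<sigma> t) has_real_derivative ?s * cos (?u \<sigma>)) (at \<sigma>)" for \<sigma> t
      unfolding x_def by (rule DERIV_cmult[OF primitive_deriv[OF c(1)]])
    show "((\<lambda>\<sigma>. y \<sigma> t) has_real_derivative ?s * sin (?u \<sigma>)) (at \<sigma>)" for \<sigma> t
      unfolding y_def using DERIV_diff[OF DERIV_cmult[OF primitive_deriv[OF c(2)]] DERIV_const] by simp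
    show "((\<lambda>t. x \<sigma> t) has_real_derivative
        - (- \<beta> * cos (?u \<sigma>)) * sin (?u \<sigma>) + - \<beta> * sin (?u \<sigma>) * cos (?u \<sigma>)) (at t)" for \<sigma> t
      unfolding x_def by simp
    have "- \<beta> * cos v * cos v + - \<beta> * sin v * sin v = - \<beta>" for v :: real
    proof -
      have "- \<beta> * cos v * cos v + - \<beta> * sin v * sin v = - \<beta> * (cos v * cos v + sin v * sin v)"
        by (simp only: distrib_left mult.assoc)
      then show ?thesis by (simp only: sin_cos_squared_add3 mult_1_right)
    qed
    then show "((\<lambda>t. y \<sigma> t) has_real_derivative
        - \<beta> * cos (?u \<sigma>) * cos (?u \<sigma>) + - \<beta> * sin (?u \<sigma>) * sin (?u \<sigma>)) (at t)" for \<sigma> t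
      unfolding y_def by (auto intro!: derivative_eq_intros)
    show "AE \<sigma> in lborel. - \<beta> * cos (?u \<sigma>) = flame_normal_velocity \<alpha> \<theta> \<sigma>"
      using G flame_G_eq[of \<theta> \<beta> \<alpha>] by eventually_elim simp
  qed
  then show ?thesis unfolding vertically_traveling_def by blast
qed

section \<open>Continuously differentiable curves and the bifurcating branch\<close>

lemma C1_differentiable_on_bounded_linear:
  assumes "bounded_linear L" "f C1_differentiable_on S"
  shows "(\<lambda>x. L (f x)) C1_differentiable_on S"
proof -
  obtain D where D: "\<And>x. x \<in> S \<Longrightarrow> (f has_vector_derivative D x) (at x)" "continuous_on S D"
    using assms(2) unfolding C1_differentiable_on_def by blast
  show ?thesis
    unfolding C1_differentiable_on_def
  proof (intro exI[of _ "\<lambda>x. L (D x)"] conjI ballI)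
    show "((\<lambda>x. L (f x)) has_vector_derivative L (D x)) (at x)" if "x \<in> S" for x
      by (rule bounded_linear.has_vector_derivative[OF assms(1) D(1)[OF that]])
    show "continuous_on S (\<lambda>x. L (D x))"
      by (rule bounded_linear.continuous_on[OF assms(1) D(2)])
  qed
qed

lemma C1_differentiable_on_Pair:
  assumes "f C1_differentiable_on S" "g C1_differentiable_on S"
  shows "(\<lambda>x. (f x, g x)) C1_differentiable_on S"
proof -
  have "bounded_linear (\<lambda>x. (x, 0))" "bounded_linear (\<lambda>x. (0, x))"
    by (intro bounded_linear_Pair bounded_linear_ident bounded_linear_zero)+
  from C1_differentiable_on_add[OF C1_differentiable_on_bounded_linear[OF this(1) assms(1)]
      C1_differentiable_on_bounded_linear[OF this(2) assms(2)]]
  show ?thesis by simp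
qed

lemma C1_differentiable_on_inverse:
  fixes f :: "real \<Rightarrow> real"
  assumes f: "f C1_differentiable_on S" and nz: "\<And>x. x \<in> S \<Longrightarrow> f x \<noteq> 0"
  shows "(\<lambda>x. inverse (f x)) C1_differentiable_on S"
proof -
  obtain D where D: "\<And>x. x \<in> S \<Longrightarrow> (f has_vector_derivative D x) (at x)" "continuous_on S D"
    using f unfolding C1_differentiable_on_def by blast
  have cf: "continuous_on S f"
    using C1_diff_imp_diff[OF f] by (rule differentiable_imp_continuous_on)
  have "((\<lambda>x. inverse (f x)) has_vector_derivative - (inverse (f x) * D x * inverse (f x))) (at x)" if "x \<in> S" for x
  proof -
    have "(f has_real_derivative D x) (at x)"
      using D(1)[OF that] by (simp add: has_real_derivative_iff_has_vector_derivative)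
    from DERIV_inverse'[OF this nz[OF that]] show ?thesis
      by (simp add: has_real_derivative_iff_has_vector_derivative)
  qed
  moreover have "continuous_on S (\<lambda>x. - (inverse (f x) * D x * inverse (f x)))"
    by (intro continuous_intros cf D ballI) (simp_all add: nz)
  ultimately show ?thesis
    unfolding C1_differentiable_on_def
    by (intro exI[of _ "\<lambda>x. - (inverse (f x) * D x * inverse (f x))"] conjI ballI)
qed

text \<open>The branch is parameterized by the amplitude \<open>w\<close>. The interval is shrunk
  until \<open>\<beta>\<close> is positive and \<open>w * m\<close> is small enough for
  \<open>reduced_solution_flame\<close>.\<close>

lemma flame_curve:
  fixes n :: nat
  assumes n: "n > 0"
  obtains \<delta> :: real and \<theta> :: "real \<Rightarrow> h3_odd" and \<beta> \<alpha> :: "real \<Rightarrow> real"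
  where "\<delta> > 0" "(\<lambda>w. (\<theta> w, \<beta> w, \<alpha> w)) C1_differentiable_on {-\<delta><..<\<delta>}"
    "(\<theta> 0, \<beta> 0, \<alpha> 0) = (0, 1, 4 * (real n)\<^sup>2 + 1)"
    "\<And>w. \<bar>w\<bar> < \<delta> \<Longrightarrow> 0 < cos_integral (\<theta> w)"
    "\<And>w. \<bar>w\<bar> < \<delta> \<Longrightarrow> AE \<sigma> in lborel. flame_G (\<theta> w) (\<beta> w) (\<alpha> w) \<sigma> = 0"
    "\<And>w. w \<noteq> 0 \<Longrightarrow> \<theta> w \<noteq> 0"
proof -
  obtain \<delta>0 d b m f where \<delta>0: "\<delta>0 > 0"
    and C: "(\<lambda>w. (d w, b w, m w, f w)) C1_differentiable_on {-\<delta>0<..<\<delta>0}"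
    and red: "\<And>w. \<bar>w\<bar> < \<delta>0 \<Longrightarrow> reduced_solution (real n) w (d w) (b w) (m w) (f w)"
    using reduced_solution_curve[of "real n"] by blast
  have lin: "bounded_linear (\<lambda>z. fst (snd z) :: real)" "bounded_linear (\<lambda>z. fst (snd (snd z)) :: real)"
    "bounded_linear (\<lambda>z. snd (snd (snd z)) :: bcf)"
    by (intro bounded_linear_fst_comp bounded_linear_snd_comp bounded_linear_ident)+
  have b: "b C1_differentiable_on {-\<delta>0<..<\<delta>0}" and m: "m C1_differentiable_on {-\<delta>0<..<\<delta>0}"
    and f: "f C1_differentiable_on {-\<delta>0<..<\<delta>0}"
    using C1_differentiable_on_bounded_linear[OF lin(1) C] C1_differentiable_on_bounded_linear[OF lin(2) C]
      C1_differentiable_on_bounded_linear[OF lin(3) C] by simp_all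
  define \<beta> where "\<beta> w = 1 + w * w * b w" for w
  \<comment> \<open>Solves \<open>(\<alpha> - 1) \<beta>\<^sup>2 / 4 = n\<^sup>2 + w m\<close> for
    \<open>\<alpha>\<close>; products and inverses replace powers and quotients to fit the
    differentiation rules for curves.\<close>
  define \<alpha> where "\<alpha> w = 1 + 4 * ((real n)\<^sup>2 + w * m w) * (inverse (\<beta> w) * inverse (\<beta> w))" for w
  define \<theta> where "\<theta> w = flame_angle n w (f w)" for w
  have cont: "isCont b 0" "isCont m 0"
    using C1_diff_imp_diff[OF b] C1_diff_imp_diff[OF m] \<delta>0
    by (auto dest!: differentiable_imp_continuous_on simp: continuous_on_eq_continuous_at)
  have "((\<lambda>w. w * w * b w) \<longlongrightarrow> 0 * 0 * b 0) (at 0)" "((\<lambda>w. \<bar>w * m w\<bar>) \<longlongrightarrow> \<bar>0 * m 0\<bar>) (at 0)"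
    by (intro tendsto_mult tendsto_rabs tendsto_ident_at cont[unfolded isCont_def])+
  then have "eventually (\<lambda>w. w * w * b w > -1) (at 0)" "eventually (\<lambda>w. \<bar>w * m w\<bar> < (real n)\<^sup>2) (at 0)"
    using n by (auto intro: order_tendstoD)
  then have "eventually (\<lambda>w. w * w * b w > -1 \<and> \<bar>w * m w\<bar> < (real n)\<^sup>2) (at 0)"
    by eventually_elim simp
  then obtain \<delta>1 where \<delta>1: "\<delta>1 > 0" "\<And>w. w \<noteq> 0 \<Longrightarrow> \<bar>w\<bar> < \<delta>1 \<Longrightarrow> w * w * b w > -1 \<and> \<bar>w * m w\<bar> < (real n)\<^sup>2"
    unfolding eventually_at by (auto simp: dist_real_def)
  define \<delta> where "\<delta> = min \<delta>0 \<delta>1"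
  \<comment> \<open>The limits at 0 say nothing about \<open>w = 0\<close> itself, where the bounds
    hold because \<open>\<beta> 0 = 1\<close> and \<open>n > 0\<close>.\<close>
  have small: "\<beta> w > 0" "\<bar>w * m w\<bar> < (real n)\<^sup>2" if "\<bar>w\<bar> < \<delta>" for w
    using \<delta>1(2)[of w] that n by (cases "w = 0"; simp add: \<beta>_def \<delta>_def)+
  have sub: "g C1_differentiable_on {-\<delta><..<\<delta>}" if "g C1_differentiable_on {-\<delta>0<..<\<delta>0}" for g :: "real \<Rightarrow> 'z::real_normed_vector"
    by (rule C1_differentiable_on_subset[OF that]) (auto simp: \<delta>_def)
  have C\<beta>: "\<beta> C1_differentiable_on {-\<delta><..<\<delta>}"
    unfolding \<beta>_def[abs_def]
    by (intro C1_differentiable_on_add C1_differentiable_on_mult C1_differentiable_on_const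
        C1_differentiable_on_ident sub[OF b])
  have "(\<lambda>w. inverse (\<beta> w)) C1_differentiable_on {-\<delta><..<\<delta>}"
  proof (rule C1_differentiable_on_inverse[OF C\<beta>])
    show "\<beta> w \<noteq> 0" if "w \<in> {-\<delta><..<\<delta>}" for w
      using small(1)[of w] that by (simp add: abs_less_iff)
  qed
  then have C\<alpha>: "\<alpha> C1_differentiable_on {-\<delta><..<\<delta>}"
    unfolding \<alpha>_def[abs_def]
    by (intro C1_differentiable_on_add C1_differentiable_on_mult C1_differentiable_on_const
        C1_differentiable_on_ident sub[OF m])
  have C\<theta>: "\<theta> C1_differentiable_on {-\<delta><..<\<delta>}"
    unfolding \<theta>_def[abs_def] flame_angle_def
    by (intro C1_differentiable_on_scaleR C1_differentiable_on_add C1_differentiable_on_const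
        C1_differentiable_on_ident C1_differentiable_on_bounded_linear[OF bounded_linear_h3_response[OF n]] sub[OF f])
  show ?thesis
  proof (rule that[of \<delta> \<theta> \<beta> \<alpha>])
    show "\<delta> > 0" using \<delta>0 \<delta>1 by (simp add: \<delta>_def)
    show "(\<lambda>w. (\<theta> w, \<beta> w, \<alpha> w)) C1_differentiable_on {-\<delta><..<\<delta>}"
      by (intro C1_differentiable_on_Pair C\<theta> C\<beta> C\<alpha>)
    show "(\<theta> 0, \<beta> 0, \<alpha> 0) = (0, 1, 4 * (real n)\<^sup>2 + 1)"
      by (simp add: \<theta>_def \<beta>_def \<alpha>_def flame_angle_def)
    show "\<theta> w \<noteq> 0" if "w \<noteq> 0" for w
      unfolding \<theta>_def by (rule flame_angle_nonzero[OF n that])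
    fix w assume w: "\<bar>w\<bar> < \<delta>"
    then have w0: "\<bar>w\<bar> < \<delta>0" by (simp add: \<delta>_def)
    have \<beta>: "\<beta> w = 1 + w\<^sup>2 * b w" by (simp add: \<beta>_def power2_eq_square)
    have \<alpha>: "\<alpha> w = 1 + 4 * ((real n)\<^sup>2 + w * m w) / (\<beta> w)\<^sup>2"
      by (simp add: \<alpha>_def power2_eq_square divide_inverse)
    note sol = reduced_solution_flame[OF n red[OF w0] small(2)[OF w] \<beta> small(1)[OF w] \<alpha>]
    show "0 < cos_integral (\<theta> w)" "AE \<sigma> in lborel. flame_G (\<theta> w) (\<beta> w) (\<alpha> w) \<sigma> = 0"
      using sol by (simp_all add: \<theta>_def)
  qed
qed

theorem theorem4:
  fixes k\<^sub>0 :: int and \<alpha>\<^sub>1 :: real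
  assumes "k\<^sub>0 \<ge> 1" and "\<alpha>\<^sub>1 = 4 * (real_of_int k\<^sub>0)\<^sup>2 + 1"
  shows "(\<forall>\<epsilon>>0. infinite {(\<theta>, \<beta>, \<alpha>). (\<theta>, \<beta>, \<alpha>) \<in> ball (0, 1, \<alpha>\<^sub>1) \<epsilon> \<and>
             vertically_traveling \<theta> \<beta> \<alpha> \<and> (\<theta>, \<beta>, \<alpha>) \<notin> trivial_solutions}) \<and>
         (\<exists>\<delta>>0. \<exists>(\<theta> :: real \<Rightarrow> h3_odd) (\<beta> :: real \<Rightarrow> real) (\<alpha> :: real \<Rightarrow> real).
             (\<lambda>\<omega>. (\<theta> \<omega>, \<beta> \<omega>, \<alpha> \<omega>)) C1_differentiable_on {-\<delta><..<\<delta>} \<and>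
             (\<theta> 0, \<beta> 0, \<alpha> 0) = (0, 1, \<alpha>\<^sub>1) \<and>
             (\<forall>\<omega>\<in>{-\<delta><..<\<delta>}. 0 < cos_integral (\<theta> \<omega>) \<and>
                (AE \<sigma> in lborel. flame_G (\<theta> \<omega>) (\<beta> \<omega>) (\<alpha> \<omega>) \<sigma> = 0)) \<and>
             (\<forall>\<omega>\<in>{-\<delta><..<\<delta>}. \<omega> \<noteq> 0 \<longrightarrow> (\<theta> \<omega>, \<beta> \<omega>, \<alpha> \<omega>) \<notin> trivial_solutions))"
proof -
  define n where "n = nat k\<^sub>0"
  have n: "n > 0" "real n = real_of_int k\<^sub>0" using assms(1) by (simp_all add: n_def)
  obtain \<delta> \<theta> \<beta> \<alpha> where \<delta>: "\<delta> > 0"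
    and C1: "(\<lambda>w. (\<theta> w, \<beta> w, \<alpha> w)) C1_differentiable_on {-\<delta><..<\<delta>}"
    and at0: "(\<theta> 0, \<beta> 0, \<alpha> 0) = (0, 1, \<alpha>\<^sub>1)"
    and pos: "\<And>w. \<bar>w\<bar> < \<delta> \<Longrightarrow> 0 < cos_integral (\<theta> w)"
    and G: "\<And>w. \<bar>w\<bar> < \<delta> \<Longrightarrow> AE \<sigma> in lborel. flame_G (\<theta> w) (\<beta> w) (\<alpha> w) \<sigma> = 0"
    and nz: "\<And>w. w \<noteq> 0 \<Longrightarrow> \<theta> w \<noteq> 0"
    by (rule flame_curve[OF n(1), unfolded n(2) assms(2)[symmetric]]) (rule that)
  have nontriv: "(\<theta> w, \<beta> w, \<alpha> w) \<notin> trivial_solutions" if "w \<noteq> 0" for w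
    using nz[OF that] by (simp add: trivial_solutions_def)
  define p where "p = (0 :: h3_odd, 1 :: real, \<alpha>\<^sub>1)"
  have "isCont (\<lambda>w. (\<theta> w, \<beta> w, \<alpha> w)) 0"
    using C1_diff_imp_diff[OF C1] \<delta>
    by (auto dest!: differentiable_imp_continuous_on simp: continuous_on_eq_continuous_at)
  then have lim: "((\<lambda>w. (\<theta> w, \<beta> w, \<alpha> w)) \<longlongrightarrow> p) (at 0)"
    unfolding isCont_def at0 p_def .
  have "infinite {(\<theta>, \<beta>, \<alpha>). (\<theta>, \<beta>, \<alpha>) \<in> ball p \<epsilon> \<and>
             vertically_traveling \<theta> \<beta> \<alpha> \<and> (\<theta>, \<beta>, \<alpha>) \<notin> trivial_solutions}" (is "infinite ?A")
    if \<epsilon>: "\<epsilon> > 0" for \<epsilon>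
  proof
    assume "finite ?A"
    \<comment> \<open>A finite set, apart from \<open>p\<close> itself, keeps a positive distance
      from \<open>p\<close>, while the curve has nontrivial points arbitrarily close to
      \<open>p\<close>.\<close>
    then obtain e where e: "e > 0" "\<And>z. z \<in> ?A \<Longrightarrow> z \<noteq> p \<Longrightarrow> e \<le> dist p z"
      using finite_set_avoid[of ?A p] by blast
    have "eventually (\<lambda>w. dist (\<theta> w, \<beta> w, \<alpha> w) p < min e \<epsilon>) (at 0)"
      using tendstoD[OF lim, of "min e \<epsilon>"] e(1) \<epsilon> by simp
    moreover have "eventually (\<lambda>w::real. \<bar>w\<bar> < \<delta> \<and> w \<noteq> 0) (at 0)"
      using \<delta> unfolding eventually_at by (auto simp: dist_real_def)
    ultimately have ev: "eventually (\<lambda>w. dist (\<theta> w, \<beta> w, \<alpha> w) p < min e \<epsilon> \<and> \<bar>w\<bar> < \<delta> \<and> w \<noteq> 0) (at 0)"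
      by eventually_elim simp
    obtain w where w: "dist (\<theta> w, \<beta> w, \<alpha> w) p < min e \<epsilon>" "\<bar>w\<bar> < \<delta>" "w \<noteq> 0"
      using eventually_happens[OF ev] by auto
    have A: "(\<theta> w, \<beta> w, \<alpha> w) \<in> ?A"
      using w nontriv[OF w(3)] vertically_travelingI[OF pos[OF w(2)] G[OF w(2)]]
      by (simp add: dist_commute)
    have "(\<theta> w, \<beta> w, \<alpha> w) \<noteq> p" using nz[OF w(3)] by (simp add: p_def)
    from e(2)[OF A this] w(1) show False by (simp add: dist_commute)
  qed
  then show ?thesis
    unfolding p_def
  proof (intro conjI exI)
    show "\<delta> > 0" by (rule \<delta>)
    show "(\<lambda>w. (\<theta> w, \<beta> w, \<alpha> w)) C1_differentiable_on {-\<delta><..<\<delta>}" by (rule C1)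
    show "(\<theta> 0, \<beta> 0, \<alpha> 0) = (0, 1, \<alpha>\<^sub>1)" by (rule at0)
    show "\<forall>w\<in>{-\<delta><..<\<delta>}. 0 < cos_integral (\<theta> w) \<and> (AE \<sigma> in lborel. flame_G (\<theta> w) (\<beta> w) (\<alpha> w) \<sigma> = 0)"
      using pos G by (simp add: abs_less_iff)
    show "\<forall>w\<in>{-\<delta><..<\<delta>}. w \<noteq> 0 \<longrightarrow> (\<theta> w, \<beta> w, \<alpha> w) \<notin> trivial_solutions"
      using nontriv by blast
  qed blast
qed

end
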